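(* Let $L$ be a pseudo-Finsler metric on $A$ with $L>0$, and let $\mathrm{Sol}_L(A)$ and $\mathrm{Sol}^{\mathrm{sym}}_L(A)$ be the sets of all solutions, respectively all symmetric solutions, $\mathrm{N}$ of the affine equation of $L$. Then for each $\mathrm{N}\in\mathrm{Sol}_L(A)$ there is a unique $\Pi(\mathrm{N})\in\mathrm{Sol}^{\mathrm{sym}}_L(A)$ such that $\mathrm{N}=\Pi(\mathrm{N})+\mathcal{A}\otimes\mathbb{C}$ for some $\mathcal{A}\in\mathrm{h}^0\mathcal{T}^0_1(M_A)$. Moreover, for each $\mathrm{N}_0\in\mathrm{Sol}^{\mathrm{sym}}_L(A)$ the fiber $\Pi^{-1}(\mathrm{N}_0)$ is isomorphic to the space $\mathrm{h}^0\mathcal{T}^0_1(M_A)$ of $0$-homogeneous anisotropic $1$-forms: the map $\mathcal{A}\mapsto \mathrm{N}_0+\mathcal{A}\otimes\mathbb{C}$ is a bijection from $\mathrm{h}^0\mathcal{T}^0_1(M_A)$ onto $\Pi^{-1}(\mathrm{N}_0)$.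
   Context: $M$ is a connected smooth manifold of dimension $n\ge 2$, $\pi:TM\to M$ the projection. Charts $(x^i)$ of $M$ induce charts $(x^i,y^i)$ of $TM$; $\partial_i=\partial/\partial x^i$, $\dot\partial_i=\partial/\partial y^i$; repeated indices are summed over $1,\dots,n$. $A\subseteq TM\setminus\mathbf{0}$ is open and conic ($\lambda v\in A$ for $v\in A$, $\lambda>0$) with $\pi(A)=M$. An anisotropic tensor of type $(r,s)$ is a smooth section of the pullback to $A$ of $\bigotimes^rTM\otimes\bigotimes^sT^*M$; it has components $T^{i_1\dots i_r}_{j_1\dots j_s}(x,y)$. It is $\alpha$-homogeneous if its components are positively $\alpha$-homogeneous in $y$; the space of these is $\mathrm{h}^\alpha\mathcal{T}^r_s(M_A)$. A subscript $\cdot i$ denotes $\dot\partial_i$. $\mathbb{C}=y^a\partial_a\in\mathrm{h}^1\mathcal{T}^1_0(M_A)$, and $(\mathcal{A}\otimes\mathbb{C})_i^k=\mathcal{A}_i y^k$. A homogeneous nonlinear connection $\mathrm{N}$ on $A$ is given in each chart by smooth functions $\mathrm{N}_i^k(x,y)$, positively $1$-homogeneous in $y$, transforming by $\bar{\mathrm{N}}_i^k=\frac{\partial\bar x^k}{\partial x^c}\frac{\partial^2x^c}{\partial\bar x^i\partial\bar x^b}\bar y^b+\frac{\partial\bar x^k}{\partial x^c}\frac{\partial x^a}{\partial\bar x^i}\mathrm{N}_a^c$. Differences of two such are elements of $\mathrm{h}^1\mathcal{T}^1_1(M_A)$, and $\mathrm{N}_0+J$ has coefficients $(\mathrm{N}_0)_i^k+J_i^k$.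 $\mathrm{N}$ is symmetric if $\mathrm{Tor}_{ij}^k=\mathrm{N}^k_{i\cdot j}-\mathrm{N}^k_{j\cdot i}=0$. A pseudo-Finsler metric on $A$ is a smooth positively $2$-homogeneous $L:A\to\mathbb{R}$ with $g_{ij}=\frac12L_{\cdot i\cdot j}$ non-degenerate everywhere; throughout $L>0$ on $A$. Indices are moved with $g$; $y_i=g_{ia}y^a$. Metric spray: $(\mathrm{G}^L)^i=\frac14g^{ia}(2\partial_cg_{ab}-\partial_ag_{bc})y^by^c$; metric (Berwald) nonlinear connection: $(\mathrm{N}^L)_i^k=\dot\partial_i(\mathrm{G}^L)^k$. Mean Cartan tensor: $\mathrm{C}_{ijk}=\frac12g_{ij\cdot k}$, $\mathrm{C}_i=g^{ab}\mathrm{C}_{abi}$. Mean Landsberg tensor: $\mathrm{Lan}_{ijk}=\frac12\nabla^L_kg_{ij}$ with $\nabla^L_kg_{ij}=(\partial_k-(\mathrm{N}^L)_k^a\dot\partial_a)g_{ij}-(\mathrm{N}^L)^a_{k\cdot i}g_{aj}-(\mathrm{N}^L)^a_{k\cdot j}g_{ia}$ (totally symmetric), $\mathrm{Lan}_i=g^{ab}\mathrm{Lan}_{abi}$. A homogeneous nonlinear connection $\mathrm{N}=\mathrm{N}^L+\mathcal{J}$, $\mathcal{J}\in\mathrm{h}^1\mathcal{T}^1_1(M_A)$, is a solution of the affine equation of $L$ if on $A$ $$\Big\{2\mathrm{Lan}_b+(n+2)\tfrac{y_a}{L}\mathcal{J}^a_b-2\mathrm{C}_a\mathcal{J}^a_b-(\mathcal{J}^a_{b\cdot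 a}+\mathcal{J}^a_{a\cdot b})\Big\}(\delta^b_iy^j-y^b\delta^j_i)-(\mathcal{J}^j_{i\cdot a}-\mathcal{J}^j_{a\cdot i})y^a=0 .$$ *)

theory Defs
  imports "HOL-Analysis.Analysis" "HOL-Library.Function_Algebras"
begin

text \<open>Smooth maps between normed spaces; only used for open sets of finite-dimensional spaces.\<close>

fun Ck_on :: "nat \<Rightarrow> 'a::real_normed_vector set \<Rightarrow> ('a \<Rightarrow> 'b::real_normed_vector) \<Rightarrow> bool" where
  "Ck_on 0 S f \<longleftrightarrow> continuous_on S f"
| "Ck_on (Suc k) S f \<longleftrightarrow>
     (\<forall>x\<in>S. f differentiable at x) \<and> (\<forall>v. Ck_on k S (\<lambda>x. frechet_derivative f (at x) v))"

definition smooth_on :: "'a::real_normed_vector set \<Rightarrow> ('a \<Rightarrow> 'b::real_normed_vector) \<Rightarrow> bool" where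
  "smooth_on S f \<longleftrightarrow> (\<forall>k. Ck_on k S f)"

definition partial :: "'n::finite \<Rightarrow> (real^'n \<Rightarrow> real) \<Rightarrow> real^'n \<Rightarrow> real" where
  "partial i f x = frechet_derivative f (at x) (axis i 1)"

text \<open>Functions of \<open>(x, y)\<close>: \<open>dx i\<close> is the derivative along \<open>x\<^sup>i\<close> and
  \<open>dy i\<close> the derivative along \<open>y\<^sup>i\<close>, written with a subscript dot in index notation.\<close>

type_synonym 'n coords = "(real^'n) \<times> (real^'n)"

definition dx :: "'n::finite \<Rightarrow> ('n coords \<Rightarrow> real) \<Rightarrow> 'n coords \<Rightarrow> real" where
  "dx i f z = frechet_derivative f (at z) (axis i 1, 0)"

definition dy :: "'n::finite \<Rightarrow> ('n coords \<Rightarrow> real) \<Rightarrow> 'n coords \<Rightarrow> real" where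
  "dy i f z = frechet_derivative f (at z) (0, axis i 1)"


section \<open>Manifolds and their tangent bundle\<close>

text \<open>A chart is a domain together with a coordinate map, whose values outside the domain are
  irrelevant. A manifold is a topological space with a smooth atlas; the atlas may be, but need not
  be, maximal.\<close>

type_synonym ('a, 'n) chart = "'a set \<times> ('a \<Rightarrow> real^'n)"

definition transition :: "('a, 'n::finite) chart \<Rightarrow> ('a, 'n) chart \<Rightarrow> real^'n \<Rightarrow> real^'n" where
  "transition c c' = snd c' \<circ> inv_into (fst c) (snd c)"

definition smooth_manifold :: "'a topology \<Rightarrow> ('a, 'n::finite) chart set \<Rightarrow> bool" where
  "smooth_manifold M \<A> \<longleftrightarrow>
     Hausdorff_space M \<and> second_countable M \<and>
     (\<Union>c\<in>\<A>. fst c) = topspace M \<and>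
     (\<forall>c\<in>\<A>. openin M (fst c) \<and> open (snd c ` fst c) \<and>
        homeomorphic_map (subtopology M (fst c)) (top_of_set (snd c ` fst c)) (snd c)) \<and>
     (\<forall>c\<in>\<A>. \<forall>c'\<in>\<A>. smooth_on (snd c ` (fst c \<inter> fst c')) (transition c c'))"

text \<open>\<open>jac c c' p k a\<close> is the derivative at \<open>p\<close> of the \<open>k\<close>-th coordinate of \<open>c'\<close> with respect to
  the \<open>a\<close>-th coordinate of \<open>c\<close>; \<open>hess c c' p k a b\<close> is the corresponding second derivative.\<close>

definition jac :: "('a, 'n::finite) chart \<Rightarrow> ('a, 'n) chart \<Rightarrow> 'a \<Rightarrow> 'n \<Rightarrow> 'n \<Rightarrow> real" where
  "jac c c' p k a = partial a (\<lambda>x. transition c c' x $ k) (snd c p)"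

definition hess :: "('a, 'n::finite) chart \<Rightarrow> ('a, 'n) chart \<Rightarrow> 'a \<Rightarrow> 'n \<Rightarrow> 'n \<Rightarrow> 'n \<Rightarrow> real" where
  "hess c c' p k a b = partial a (partial b (\<lambda>x. transition c c' x $ k)) (snd c p)"

text \<open>A tangent vector is a point together with its components in all charts around that point,
  related by the Jacobians of the coordinate changes. Components are set to zero in the charts
  that do not contain the point, so that equality of tangent vectors is equality of pairs.\<close>

type_synonym ('a, 'n) tvec = "'a \<times> (('a, 'n) chart \<Rightarrow> real^'n)"

definition tangent_bundle :: "('a, 'n::finite) chart set \<Rightarrow> ('a, 'n) tvec set" where
  "tangent_bundle \<A> = {(p, v).
     p \<in> (\<Union>c\<in>\<A>. fst c) \<and>
     (\<forall>c\<in>\<A>. \<forall>c'\<in>\<A>. p \<in> fst c \<longrightarrow> p \<in> fst c' \<longrightarrow>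
        (\<forall>k. v c' $ k = (\<Sum>a\<in>UNIV. jac c c' p k a * v c $ a))) \<and>
     (\<forall>c. \<not> (c \<in> \<A> \<and> p \<in> fst c) \<longrightarrow> v c = 0)}"

definition zero_section :: "('a, 'n::finite) chart set \<Rightarrow> ('a, 'n) tvec set" where
  "zero_section \<A> = {(p, \<lambda>_. 0) | p. p \<in> (\<Union>c\<in>\<A>. fst c)}"

definition scale_tvec :: "real \<Rightarrow> ('a, 'n::finite) tvec \<Rightarrow> ('a, 'n) tvec" where
  "scale_tvec r v = (fst v, \<lambda>c. r *\<^sub>R snd v c)"

text \<open>The chart \<open>(x, y)\<close> of the tangent bundle induced by a chart of the manifold, and its inverse.\<close>

definition ind_chart :: "('a, 'n::finite) chart \<Rightarrow> ('a, 'n) tvec \<Rightarrow> 'n coords" where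
  "ind_chart c v = (snd c (fst v), snd v c)"

definition ind_chart_inv ::
  "('a, 'n::finite) chart set \<Rightarrow> ('a, 'n) chart \<Rightarrow> 'n coords \<Rightarrow> ('a, 'n) tvec" where
  "ind_chart_inv \<A> c = inv_into {v \<in> tangent_bundle \<A>. fst v \<in> fst c} (ind_chart c)"

definition coord_dom :: "('a, 'n::finite) tvec set \<Rightarrow> ('a, 'n) chart \<Rightarrow> 'n coords set" where
  "coord_dom A c = ind_chart c ` {v \<in> A. fst v \<in> fst c}"

text \<open>The openness clause is openness in the topology for which the induced charts of the tangent
  bundle are homeomorphisms on open sets.\<close>

definition open_conic :: "'a topology \<Rightarrow> ('a, 'n::finite) chart set \<Rightarrow> ('a, 'n) tvec set \<Rightarrow> bool" where
  "open_conic M \<A> A \<longleftrightarrow>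
     A \<subseteq> tangent_bundle \<A> - zero_section \<A> \<and>
     (\<forall>c\<in>\<A>. open (coord_dom A c)) \<and>
     (\<forall>v\<in>A. \<forall>r>0. scale_tvec r v \<in> A) \<and>
     fst ` A = topspace M"


section \<open>Anisotropic tensors and nonlinear connections\<close>

text \<open>Anisotropic objects assign to every \<open>v \<in> A\<close> an array of components for each chart around the
  base point of \<open>v\<close>; all other values are zero, so that equality is equality of functions. An upper
  index is a row index and a lower index a column index: \<open>T v c $ k $ i\<close> stands for \<open>T\<^sup>k\<^sub>i\<close>.\<close>

type_synonym ('a, 'n, 'b) aniso = "('a, 'n) tvec \<Rightarrow> ('a, 'n) chart \<Rightarrow> 'b"

definition local_fun ::
  "('a, 'n::finite) chart set \<Rightarrow> ('a, 'n) chart \<Rightarrow> (('a, 'n) tvec \<Rightarrow> 'b) \<Rightarrow> 'n coords \<Rightarrow> 'b" where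
  "local_fun \<A> c F z = F (ind_chart_inv \<A> c z)"

definition local_comp ::
  "('a, 'n::finite) chart set \<Rightarrow> ('a, 'n) chart \<Rightarrow> ('a, 'n, real^'n^'n) aniso \<Rightarrow>
     'n \<Rightarrow> 'n \<Rightarrow> 'n coords \<Rightarrow> real" where
  "local_comp \<A> c T k i z = local_fun \<A> c (\<lambda>v. T v c) z $ k $ i"

definition pos_homogeneous ::
  "('a, 'n::finite) tvec set \<Rightarrow> real \<Rightarrow> (('a, 'n) tvec \<Rightarrow> 'b::real_vector) \<Rightarrow> bool" where
  "pos_homogeneous A \<alpha> F \<longleftrightarrow> (\<forall>v\<in>A. \<forall>r>0. F (scale_tvec r v) = (r powr \<alpha>) *\<^sub>R F v)"

definition smooth_hom_components ::
  "('a, 'n::finite) chart set \<Rightarrow> ('a, 'n) tvec set \<Rightarrow> real \<Rightarrow>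
     ('a, 'n, 'b::real_normed_vector) aniso \<Rightarrow> bool" where
  "smooth_hom_components \<A> A \<alpha> F \<longleftrightarrow>
     (\<forall>c\<in>\<A>. smooth_on (coord_dom A c) (local_fun \<A> c (\<lambda>v. F v c)) \<and>
            pos_homogeneous A \<alpha> (\<lambda>v. F v c)) \<and>
     (\<forall>v c. \<not> (v \<in> A \<and> c \<in> \<A> \<and> fst v \<in> fst c) \<longrightarrow> F v c = 0)"

text \<open>The \<open>\<alpha>\<close>-homogeneous anisotropic tensors of types \<open>(0,1)\<close> and \<open>(1,1)\<close>: smooth sections over \<open>A\<close>
  of the pulled-back tensor bundle. As for tangent vectors, an element of the fiber over \<open>v\<close> is given
  by its components in all charts, subject to the tensorial transformation law.\<close>

definition hT01 ::
  "('a, 'n::finite) chart set \<Rightarrow> ('a, 'n) tvec set \<Rightarrow> real \<Rightarrow> ('a, 'n, real^'n) aniso set" where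
  "hT01 \<A> A \<alpha> = {T. smooth_hom_components \<A> A \<alpha> T \<and>
     (\<forall>v\<in>A. \<forall>c\<in>\<A>. \<forall>c'\<in>\<A>. fst v \<in> fst c \<longrightarrow> fst v \<in> fst c' \<longrightarrow>
        (\<forall>i. T v c' $ i = (\<Sum>a\<in>UNIV. jac c' c (fst v) a i * T v c $ a)))}"

definition hT11 ::
  "('a, 'n::finite) chart set \<Rightarrow> ('a, 'n) tvec set \<Rightarrow> real \<Rightarrow> ('a, 'n, real^'n^'n) aniso set" where
  "hT11 \<A> A \<alpha> = {T. smooth_hom_components \<A> A \<alpha> T \<and>
     (\<forall>v\<in>A. \<forall>c\<in>\<A>. \<forall>c'\<in>\<A>. fst v \<in> fst c \<longrightarrow> fst v \<in> fst c' \<longrightarrow>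
        (\<forall>i k. T v c' $ k $ i =
           (\<Sum>b\<in>UNIV. \<Sum>a\<in>UNIV.
              jac c c' (fst v) k b * jac c' c (fst v) a i * T v c $ b $ a)))}"

text \<open>The tensor product of a one-form with the canonical section \<open>v \<mapsto> v\<close>, whose components are
  \<open>y\<^sup>k\<close>.\<close>

definition tensor_canonical ::
  "('a, 'n::finite, real^'n) aniso \<Rightarrow> ('a, 'n, real^'n^'n) aniso" where
  "tensor_canonical T v c = (\<chi> k i. T v c $ i * snd v c $ k)"

definition hom_nonlinear_connections ::
  "('a, 'n::finite) chart set \<Rightarrow> ('a, 'n) tvec set \<Rightarrow> ('a, 'n, real^'n^'n) aniso set" where
  "hom_nonlinear_connections \<A> A = {N. smooth_hom_components \<A> A 1 N \<and>
     (\<forall>v\<in>A. \<forall>c\<in>\<A>. \<forall>c'\<in>\<A>. fst v \<in> fst c \<longrightarrow> fst v \<in> fst c' \<longrightarrow>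
        (\<forall>i k. N v c' $ k $ i =
           (\<Sum>d\<in>UNIV. \<Sum>b\<in>UNIV.
              jac c c' (fst v) k d * hess c' c (fst v) d i b * snd v c' $ b) +
           (\<Sum>d\<in>UNIV. \<Sum>a\<in>UNIV.
              jac c c' (fst v) k d * jac c' c (fst v) a i * N v c $ d $ a)))}"

definition symmetric_connection ::
  "('a, 'n::finite) chart set \<Rightarrow> ('a, 'n) tvec set \<Rightarrow> ('a, 'n, real^'n^'n) aniso \<Rightarrow> bool" where
  "symmetric_connection \<A> A N \<longleftrightarrow>
     (\<forall>c\<in>\<A>. \<forall>z\<in>coord_dom A c. \<forall>i j k.
        dy j (local_comp \<A> c N k i) z - dy i (local_comp \<A> c N k j) z = 0)"


section \<open>Local formulas for pseudo-Finsler metrics\<close>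

text \<open>In this section \<open>l\<close> is the coordinate expression of the metric function in an induced chart.\<close>

definition fund :: "('n::finite coords \<Rightarrow> real) \<Rightarrow> 'n \<Rightarrow> 'n \<Rightarrow> 'n coords \<Rightarrow> real" where
  "fund l i j z = 1/2 * dy j (dy i l) z"

definition fund_inv :: "('n::finite coords \<Rightarrow> real) \<Rightarrow> 'n \<Rightarrow> 'n \<Rightarrow> 'n coords \<Rightarrow> real" where
  "fund_inv l i j z = matrix_inv (\<chi> a b. fund l a b z) $ i $ j"

definition spray :: "('n::finite coords \<Rightarrow> real) \<Rightarrow> 'n \<Rightarrow> 'n coords \<Rightarrow> real" where
  "spray l i z = 1/4 * (\<Sum>a\<in>UNIV. \<Sum>b\<in>UNIV. \<Sum>c\<in>UNIV.
     fund_inv l i a z * (2 * dx c (fund l a b) z - dx a (fund l b c) z) * snd z $ b * snd z $ c)"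

definition berwald :: "('n::finite coords \<Rightarrow> real) \<Rightarrow> 'n \<Rightarrow> 'n \<Rightarrow> 'n coords \<Rightarrow> real" where
  "berwald l k i z = dy i (spray l k) z"

definition cartan :: "('n::finite coords \<Rightarrow> real) \<Rightarrow> 'n \<Rightarrow> 'n \<Rightarrow> 'n \<Rightarrow> 'n coords \<Rightarrow> real" where
  "cartan l i j k z = 1/2 * dy k (fund l i j) z"

definition mean_cartan :: "('n::finite coords \<Rightarrow> real) \<Rightarrow> 'n \<Rightarrow> 'n coords \<Rightarrow> real" where
  "mean_cartan l i z = (\<Sum>a\<in>UNIV. \<Sum>b\<in>UNIV. fund_inv l a b z * cartan l a b i z)"

definition landsberg :: "('n::finite coords \<Rightarrow> real) \<Rightarrow> 'n \<Rightarrow> 'n \<Rightarrow> 'n \<Rightarrow> 'n coords \<Rightarrow> real" where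
  "landsberg l i j k z = 1/2 *
     ((dx k (fund l i j) z - (\<Sum>a\<in>UNIV. berwald l a k z * dy a (fund l i j) z))
      - (\<Sum>a\<in>UNIV. dy i (berwald l a k) z * fund l a j z)
      - (\<Sum>a\<in>UNIV. dy j (berwald l a k) z * fund l i a z))"

definition mean_landsberg :: "('n::finite coords \<Rightarrow> real) \<Rightarrow> 'n \<Rightarrow> 'n coords \<Rightarrow> real" where
  "mean_landsberg l i z = (\<Sum>a\<in>UNIV. \<Sum>b\<in>UNIV. fund_inv l a b z * landsberg l a b i z)"

definition lower_y :: "('n::finite coords \<Rightarrow> real) \<Rightarrow> 'n \<Rightarrow> 'n coords \<Rightarrow> real" where
  "lower_y l i z = (\<Sum>a\<in>UNIV. fund l i a z * snd z $ a)"

text \<open>The expression in braces, with free lower index \<open>b\<close>, and the left-hand side of the affine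
  equation; \<open>J k i\<close> is the component \<open>J\<^sup>k\<^sub>i\<close>.\<close>

definition affine_brace ::
  "('n::finite coords \<Rightarrow> real) \<Rightarrow> ('n \<Rightarrow> 'n \<Rightarrow> 'n coords \<Rightarrow> real) \<Rightarrow> 'n \<Rightarrow> 'n coords \<Rightarrow> real" where
  "affine_brace l J b z =
     2 * mean_landsberg l b z
     + (real CARD('n) + 2) * (\<Sum>a\<in>UNIV. lower_y l a z / l z * J a b z)
     - 2 * (\<Sum>a\<in>UNIV. mean_cartan l a z * J a b z)
     - (\<Sum>a\<in>UNIV. dy a (J a b) z + dy b (J a a) z)"

definition affine_lhs ::
  "('n::finite coords \<Rightarrow> real) \<Rightarrow> ('n \<Rightarrow> 'n \<Rightarrow> 'n coords \<Rightarrow> real) \<Rightarrow> 'n \<Rightarrow> 'n \<Rightarrow> 'n coords \<Rightarrow> real" where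
  "affine_lhs l J i j z =
     (\<Sum>b\<in>UNIV. affine_brace l J b z *
        ((if b = i then 1 else 0) * snd z $ j - snd z $ b * (if j = i then 1 else 0)))
     - (\<Sum>a\<in>UNIV. (dy a (J j i) z - dy i (J j a) z) * snd z $ a)"


section \<open>Pseudo-Finsler metrics and solutions of the affine equation\<close>

text \<open>The values of \<open>L\<close> outside \<open>A\<close> are irrelevant.\<close>

definition pseudo_Finsler ::
  "('a, 'n::finite) chart set \<Rightarrow> ('a, 'n) tvec set \<Rightarrow> (('a, 'n) tvec \<Rightarrow> real) \<Rightarrow> bool" where
  "pseudo_Finsler \<A> A L \<longleftrightarrow>
     (\<forall>c\<in>\<A>. smooth_on (coord_dom A c) (local_fun \<A> c L)) \<and>
     pos_homogeneous A 2 L \<and>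
     (\<forall>c\<in>\<A>. \<forall>z\<in>coord_dom A c. invertible (\<chi> i j. fund (local_fun \<A> c L) i j z))"

definition metric_connection ::
  "('a, 'n::finite) chart set \<Rightarrow> ('a, 'n) tvec set \<Rightarrow> (('a, 'n) tvec \<Rightarrow> real) \<Rightarrow>
     ('a, 'n, real^'n^'n) aniso" where
  "metric_connection \<A> A L v c =
     (if v \<in> A \<and> c \<in> \<A> \<and> fst v \<in> fst c
      then (\<chi> k i. berwald (local_fun \<A> c L) k i (ind_chart c v)) else 0)"

definition Sol ::
  "('a, 'n::finite) chart set \<Rightarrow> ('a, 'n) tvec set \<Rightarrow> (('a, 'n) tvec \<Rightarrow> real) \<Rightarrow>
     ('a, 'n, real^'n^'n) aniso set" where
  "Sol \<A> A L = {N \<in> hom_nonlinear_connections \<A> A.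
     \<exists>J\<in>hT11 \<A> A 1. N = metric_connection \<A> A L + J \<and>
       (\<forall>c\<in>\<A>. \<forall>z\<in>coord_dom A c. \<forall>i j.
          affine_lhs (local_fun \<A> c L) (local_comp \<A> c J) i j z = 0)}"

definition Sol_sym ::
  "('a, 'n::finite) chart set \<Rightarrow> ('a, 'n) tvec set \<Rightarrow> (('a, 'n) tvec \<Rightarrow> real) \<Rightarrow>
     ('a, 'n, real^'n^'n) aniso set" where
  "Sol_sym \<A> A L = {N \<in> Sol \<A> A L. symmetric_connection \<A> A N}"

text \<open>Meaningful for \<open>N \<in> Sol \<A> A L\<close> once existence and uniqueness have been established.\<close>

definition sym_projection ::
  "('a, 'n::finite) chart set \<Rightarrow> ('a, 'n) tvec set \<Rightarrow> (('a, 'n) tvec \<Rightarrow> real) \<Rightarrow>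
     ('a, 'n, real^'n^'n) aniso \<Rightarrow> ('a, 'n, real^'n^'n) aniso" where
  "sym_projection \<A> A L N =
     (THE N'. N' \<in> Sol_sym \<A> A L \<and> (\<exists>T\<in>hT01 \<A> A 0. N = N' + tensor_canonical T))"

end

theory Submission
  imports Defs
begin

text \<open>Write \<open>T\<^sup>j\<^sub>i = (J\<^sup>j\<^sub>i\<^sub>\<cdot>\<^sub>a - J\<^sup>j\<^sub>a\<^sub>\<cdot>\<^sub>i) y\<^sup>a\<close> for the contracted torsion of a
  \<open>1\<close>-homogeneous tensor \<open>J\<close> and \<open>B\<^sub>b\<close> for the expression in braces. The affine equation then says
  \<open>T\<^sup>j\<^sub>i = B\<^sub>i y\<^sup>j - B\<^sub>0 \<delta>\<^sup>j\<^sub>i\<close> with \<open>B\<^sub>0 = B\<^sub>b y\<^sup>b\<close>. Replace \<open>J\<close> by \<open>J + Q \<otimes> \<C>\<close> with a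
  \<open>0\<close>-homogeneous one-form \<open>Q\<close>, and put \<open>Q\<^sub>0 = Q\<^sub>a y\<^sup>a\<close>. Euler's theorem,
  \<open>y\<^sub>a y\<^sup>a = L\<close> and \<open>C\<^sub>a y\<^sup>a = 0\<close> give that \<open>B\<^sub>b\<close> changes by \<open>W\<^sub>b = 2 Q\<^sub>b - Q\<^sub>0\<^sub>\<cdot>\<^sub>b\<close> and
  \<open>T\<^sup>j\<^sub>i\<close> by \<open>W\<^sub>i y\<^sup>j - Q\<^sub>0 \<delta>\<^sup>j\<^sub>i\<close>. As \<open>W\<^sub>b y\<^sup>b = Q\<^sub>0\<close>, both sides of the equation change by the same
  amount: the affine equation is invariant under adding \<open>Q \<otimes> \<C>\<close> (lemma \<open>affine_lhs_shift\<close>).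

  The theorem thus reduces to choosing \<open>Q\<close> so that \<open>J + Q \<otimes> \<C>\<close> is symmetric. Since
  \<open>T\<^sup>j\<^sub>i = 2 J\<^sup>j\<^sub>i - (J\<^sup>j\<^sub>a y\<^sup>a)\<^sub>\<cdot>\<^sub>i\<close>, a tensor with \<open>T = 0\<close> is half a vertical derivative, and it is symmetric
  because mixed derivatives commute (lemma \<open>torsion_free_imp_symmetric\<close>). For a solution,
  \<open>Q\<^sub>i = - (B\<^sub>i + B\<^sub>0\<^sub>\<cdot>\<^sub>i) / 2\<close> makes the contracted torsion vanish (lemma \<open>symmetrizer_removes_torsion\<close>).
  Conversely, in dimension at least two \<open>W\<^sub>i y\<^sup>j = Q\<^sub>0 \<delta>\<^sup>j\<^sub>i\<close> forces \<open>Q\<^sub>0 = 0\<close> and then \<open>Q = 0\<close>, so no other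
  one-form does this (lemma \<open>contracted_torsion_shift_inj\<close>).

  It remains to see that this \<open>Q\<close> is a smooth anisotropic one-form. The definition of \<open>B\<close> through the
  mean Landsberg tensor would require the covariance of the metric connection. On solutions this is
  avoided by recovering \<open>B\<close> from \<open>T\<close>: taking the trace gives \<open>B\<^sub>0 = - T\<^sup>i\<^sub>i / (n - 1)\<close>, and contracting
  with \<open>y\<close> in Euclidean coordinates gives \<open>B\<^sub>i = (T\<^sup>j\<^sub>i + B\<^sub>0 \<delta>\<^sup>j\<^sub>i) y\<^sup>j / \<bar>y\<bar>\<^sup>2\<close>, where \<open>T\<close> is a tensor
  because \<open>J\<close> is one.\<close>

section \<open>Calculus of smooth maps\<close>

lemma Ck_on_cong:
  assumes "open S" "\<And>x. x \<in> S \<Longrightarrow> f x = g x" "Ck_on k S f"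
  shows "Ck_on k S g"
  using assms(2,3)
proof (induction k arbitrary: f g)
  case 0
  then show ?case
    using continuous_on_cong by fastforce
next
  case (Suc k)
  have der: "(g has_derivative frechet_derivative f (at x)) (at x)" if "x \<in> S" for x
    using has_derivative_transform_within_open[OF _ \<open>open S\<close> that, of f _ UNIV g] Suc.prems that
    by (simp add: frechet_derivative_works)
  then have "frechet_derivative f (at x) = frechet_derivative g (at x)" if "x \<in> S" for x
    using that by (simp add: frechet_derivative_at)
  then have "Ck_on k S (\<lambda>x. frechet_derivative g (at x) v)" for v
    using Suc.IH[of "\<lambda>x. frechet_derivative f (at x) v" "\<lambda>x. frechet_derivative g (at x) v"] Suc.prems
    by simp
  then show ?case
    using der by (auto simp: differentiable_def)
qed

text \<open>Lets smoothness be proved with whatever derivative the differentiation rules produce, in place of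
  the one that \<open>frechet_derivative\<close> chooses.\<close>

lemma Ck_on_SucI:
  assumes "open S" "\<And>x. x \<in> S \<Longrightarrow> (f has_derivative f' x) (at x)"
    "\<And>v. Ck_on k S (\<lambda>x. f' x v)"
  shows "Ck_on (Suc k) S f"
proof -
  have "Ck_on k S (\<lambda>x. frechet_derivative f (at x) v)" for v
    by (rule Ck_on_cong[OF assms(1) _ assms(3)[of v]]) (simp add: frechet_derivative_at[OF assms(2)])
  then show ?thesis
    using assms(2) by (auto simp: differentiable_def)
qed

lemma Ck_on_Suc_has_derivative:
  "Ck_on (Suc k) S f \<Longrightarrow> x \<in> S \<Longrightarrow> (f has_derivative frechet_derivative f (at x)) (at x)"
  using frechet_derivative_works by auto

lemma Ck_on_Suc_derivative: "Ck_on (Suc k) S f \<Longrightarrow> Ck_on k S (\<lambda>x. frechet_derivative f (at x) v)"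
  by simp

lemma Ck_on_SucD: "Ck_on (Suc k) S f \<Longrightarrow> Ck_on k S f"
proof (induction k arbitrary: f)
  case 0
  then show ?case
    by (auto intro!: continuous_at_imp_continuous_on differentiable_imp_continuous_within)
next
  case (Suc k)
  have "Ck_on k S (\<lambda>x. frechet_derivative f (at x) v)" for v
    by (rule Suc.IH[OF Ck_on_Suc_derivative[OF Suc.prems]])
  with Suc.prems show ?case
    by simp
qed

lemma Ck_on_const: "open S \<Longrightarrow> Ck_on k S (\<lambda>x. c)"
  by (induction k arbitrary: c) auto

lemma Ck_on_bounded_linear:
  assumes "open S" "bounded_linear h"
  shows "Ck_on k S f \<Longrightarrow> Ck_on k S (\<lambda>x. h (f x))"
proof (induction k arbitrary: f)
  case 0
  then show ?case
    using assms(2) by (simp add: bounded_linear.continuous_on)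
next
  case (Suc k)
  show ?case
    by (rule Ck_on_SucI[OF assms(1), where f' = "\<lambda>x v. h (frechet_derivative f (at x) v)"];
        intro bounded_linear.has_derivative[OF assms(2)] Suc.IH Ck_on_Suc_has_derivative[OF Suc.prems] Ck_on_Suc_derivative[OF Suc.prems])
qed

lemma Ck_on_add:
  assumes "open S"
  shows "Ck_on k S f \<Longrightarrow> Ck_on k S g \<Longrightarrow> Ck_on k S (\<lambda>x. f x + g x)"
proof (induction k arbitrary: f g)
  case 0
  then show ?case by (simp add: continuous_on_add)
next
  case (Suc k)
  show ?case
    by (rule Ck_on_SucI[OF assms(1),
          where f' = "\<lambda>x v. frechet_derivative f (at x) v + frechet_derivative g (at x) v"];
        intro has_derivative_add Suc.IH
        Ck_on_Suc_has_derivative[OF Suc.prems(1)] Ck_on_Suc_derivative[OF Suc.prems(1)]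
        Ck_on_Suc_has_derivative[OF Suc.prems(2)] Ck_on_Suc_derivative[OF Suc.prems(2)])
qed

lemma Ck_on_mult:
  fixes f g :: "'a::real_normed_vector \<Rightarrow> real"
  assumes "open S"
  shows "Ck_on k S f \<Longrightarrow> Ck_on k S g \<Longrightarrow> Ck_on k S (\<lambda>x. f x * g x)"
proof (induction k arbitrary: f g)
  case 0
  then show ?case by (simp add: continuous_on_mult)
next
  case (Suc k)
  show ?case
  proof (intro Ck_on_SucI[OF assms])
    show "((\<lambda>x. f x * g x) has_derivative
        (\<lambda>v. f x * frechet_derivative g (at x) v + frechet_derivative f (at x) v * g x)) (at x)"
      if "x \<in> S" for x
      by (intro has_derivative_mult that
          Ck_on_Suc_has_derivative[OF Suc.prems(1)] Ck_on_Suc_has_derivative[OF Suc.prems(2)])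
    show "Ck_on k S (\<lambda>x. f x * frechet_derivative g (at x) v + frechet_derivative f (at x) v * g x)" for v
      by (intro Ck_on_add[OF assms] Suc.IH
          Ck_on_SucD[OF Suc.prems(1)] Ck_on_Suc_derivative[OF Suc.prems(1)]
          Ck_on_SucD[OF Suc.prems(2)] Ck_on_Suc_derivative[OF Suc.prems(2)])
  qed
qed

lemma Ck_on_inverse:
  fixes f :: "'a::real_normed_vector \<Rightarrow> real"
  assumes "open S" "\<And>x. x \<in> S \<Longrightarrow> f x \<noteq> 0"
  shows "Ck_on k S f \<Longrightarrow> Ck_on k S (\<lambda>x. inverse (f x))"
proof (induction k)
  case 0
  then show ?case using assms(2) by (simp add: continuous_on_inverse)
next
  case (Suc k)
  show ?case
  proof (intro Ck_on_SucI[OF assms(1)])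
    show "((\<lambda>x. inverse (f x)) has_derivative
        (\<lambda>v. - (inverse (f x) * frechet_derivative f (at x) v * inverse (f x)))) (at x)"
      if "x \<in> S" for x
      by (intro Deriv.has_derivative_inverse that assms(2) Ck_on_Suc_has_derivative[OF Suc.prems])
    show "Ck_on k S (\<lambda>x. - (inverse (f x) * frechet_derivative f (at x) v * inverse (f x)))" for v
      by (intro Ck_on_bounded_linear[OF assms(1) bounded_linear_minus[OF bounded_linear_ident]]
            Ck_on_mult[OF assms(1)] Suc.IH Ck_on_SucD[OF Suc.prems] Ck_on_Suc_derivative[OF Suc.prems])
  qed
qed

lemma Ck_on_linear:
  assumes "open S" "bounded_linear h"
  shows "Ck_on k S h"
proof (cases k)
  case 0
  then show ?thesis
    using assms(2) by (simp add: linear_continuous_on)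
next
  case (Suc m)
  have "Ck_on (Suc m) S h"
    by (rule Ck_on_SucI[where f' = "\<lambda>x. h"])
       (auto simp: assms Ck_on_const bounded_linear_imp_has_derivative)
  then show ?thesis
    using Suc by simp
qed

lemma smooth_on_cong:
  "open S \<Longrightarrow> (\<And>x. x \<in> S \<Longrightarrow> f x = g x) \<Longrightarrow> smooth_on S f \<Longrightarrow> smooth_on S g"
  unfolding smooth_on_def using Ck_on_cong by blast

lemma smooth_on_const: "open S \<Longrightarrow> smooth_on S (\<lambda>x. c)"
  by (simp add: smooth_on_def Ck_on_const)

lemma smooth_on_linear: "open S \<Longrightarrow> bounded_linear h \<Longrightarrow> smooth_on S h"
  by (simp add: smooth_on_def Ck_on_linear)

lemma smooth_on_bounded_linear:
  "open S \<Longrightarrow> bounded_linear h \<Longrightarrow> smooth_on S f \<Longrightarrow> smooth_on S (\<lambda>x. h (f x))"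
  by (simp add: smooth_on_def Ck_on_bounded_linear)

lemma smooth_on_add:
  "open S \<Longrightarrow> smooth_on S f \<Longrightarrow> smooth_on S g \<Longrightarrow> smooth_on S (\<lambda>x. f x + g x)"
  by (simp add: smooth_on_def Ck_on_add)

lemma smooth_on_minus: "open S \<Longrightarrow> smooth_on S f \<Longrightarrow> smooth_on S (\<lambda>x. - f x)"
  using smooth_on_bounded_linear[OF _ bounded_linear_minus[OF bounded_linear_ident]] .

lemma smooth_on_diff:
  "open S \<Longrightarrow> smooth_on S f \<Longrightarrow> smooth_on S g \<Longrightarrow> smooth_on S (\<lambda>x. f x - g x)"
  using smooth_on_add[of S f "\<lambda>x. - g x"] smooth_on_minus by auto

lemma smooth_on_sum:
  "open S \<Longrightarrow> (\<And>i. i \<in> I \<Longrightarrow> smooth_on S (f i)) \<Longrightarrow> smooth_on S (\<lambda>x. \<Sum>i\<in>I. f i x)"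
  by (induction I rule: infinite_finite_induct) (auto intro: smooth_on_add smooth_on_const)

lemma smooth_on_mult:
  fixes f g :: "'a::real_normed_vector \<Rightarrow> real"
  shows "open S \<Longrightarrow> smooth_on S f \<Longrightarrow> smooth_on S g \<Longrightarrow> smooth_on S (\<lambda>x. f x * g x)"
  by (simp add: smooth_on_def Ck_on_mult)

lemma smooth_on_divide:
  fixes f g :: "'a::real_normed_vector \<Rightarrow> real"
  assumes "open S" "smooth_on S f" "smooth_on S g" "\<And>x. x \<in> S \<Longrightarrow> g x \<noteq> 0"
  shows "smooth_on S (\<lambda>x. f x / g x)"
  using assms unfolding divide_inverse by (simp add: smooth_on_def Ck_on_mult Ck_on_inverse)

lemma smooth_on_prod:
  fixes f :: "'i \<Rightarrow> 'a::real_normed_vector \<Rightarrow> real"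
  shows "open S \<Longrightarrow> (\<And>i. i \<in> I \<Longrightarrow> smooth_on S (f i)) \<Longrightarrow> smooth_on S (\<lambda>x. \<Prod>i\<in>I. f i x)"
  by (induction I rule: infinite_finite_induct) (auto intro: smooth_on_mult smooth_on_const)

lemma smooth_on_frechet_derivative:
  "smooth_on S f \<Longrightarrow> smooth_on S (\<lambda>x. frechet_derivative f (at x) v)"
  unfolding smooth_on_def using Ck_on.simps(2) by blast

lemma smooth_on_imp_has_derivative:
  assumes "smooth_on S f" "x \<in> S"
  shows "(f has_derivative frechet_derivative f (at x)) (at x)"
proof -
  have "Ck_on (Suc 0) S f"
    using assms(1) by (simp only: smooth_on_def)
  then show ?thesis
    using assms(2) by (simp add: frechet_derivative_works)
qed

lemma smooth_on_vec_nth: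
  "open S \<Longrightarrow> smooth_on S F \<Longrightarrow> smooth_on S (\<lambda>x. F x $ i)"
  by (rule smooth_on_bounded_linear[OF _ bounded_linear_vec_nth])

lemma smooth_on_vec:
  fixes F :: "'a::real_normed_vector \<Rightarrow> 'b::real_normed_vector^'n"
  assumes "open S" "\<And>i. smooth_on S (\<lambda>x. F x $ i)"
  shows "smooth_on S F"
proof -
  have lin: "bounded_linear (axis i :: 'b \<Rightarrow> 'b^'n)" for i :: 'n
  proof (rule bounded_linear_intro[where K = 1])
    show "norm (axis i x :: 'b^'n) \<le> norm x * 1" for x :: 'b
      by (simp add: norm_vec_def L2_set_def axis_def if_distrib[of norm] if_distrib[of "\<lambda>t. t\<^sup>2"]
          cong: if_cong)
  qed (simp_all add: axis_def vec_eq_iff)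
  have "F = (\<lambda>x. \<Sum>i\<in>UNIV. axis i (F x $ i))"
    by (auto simp: vec_eq_iff axis_def if_distrib cong: if_cong)
  moreover have "smooth_on S (\<lambda>x. \<Sum>i\<in>UNIV. axis i (F x $ i))"
    by (intro smooth_on_sum[OF assms(1)] smooth_on_bounded_linear[OF assms(1) lin] assms(2))
  ultimately show ?thesis
    by simp
qed

lemma smooth_on_det:
  fixes F :: "'n::finite \<Rightarrow> 'n \<Rightarrow> 'a::real_normed_vector \<Rightarrow> real"
  assumes "open S" "\<And>i j. smooth_on S (F i j)"
  shows "smooth_on S (\<lambda>x. det (\<chi> i j. F i j x))"
  unfolding det_def using assms
  by (auto intro!: smooth_on_sum smooth_on_mult smooth_on_prod smooth_on_const)

text \<open>Cramer's rule exhibits the entries of an inverse matrix as quotients of polynomials in the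
  entries of the matrix.\<close>

lemma smooth_on_matrix_inv:
  fixes F :: "'n::finite \<Rightarrow> 'n \<Rightarrow> 'a::real_normed_vector \<Rightarrow> real"
  assumes S: "open S" and F: "\<And>i j. smooth_on S (F i j)"
    and inv: "\<And>x. x \<in> S \<Longrightarrow> invertible (\<chi> i j. F i j x)"
  shows "smooth_on S (\<lambda>x. matrix_inv (\<chi> i j. F i j x) $ i $ j)"
proof (rule smooth_on_cong[OF S])
  let ?A = "\<lambda>x. (\<chi> i j. F i j x)"
  let ?d = "\<lambda>x. det (\<chi> r s. if s = i then axis j 1 $ r else F r s x)"
  have nz: "det (?A x) \<noteq> 0" if "x \<in> S" for x
    using inv[OF that] invertible_det_nz by blast
  show "smooth_on S (\<lambda>x. ?d x / det (?A x))"
  proof (intro smooth_on_divide smooth_on_det S F nz)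
    show "smooth_on S (\<lambda>x. if s = i then axis j 1 $ r else F r s x)" for r s
      by (cases "s = i") (simp_all add: F smooth_on_const[OF S])
  qed
  show "?d x / det (?A x) = matrix_inv (?A x) $ i $ j" if "x \<in> S" for x
  proof -
    have "?A x *v column j (matrix_inv (?A x)) = column j (?A x ** matrix_inv (?A x))"
      by (simp add: vec_eq_iff column_def matrix_vector_mult_def matrix_matrix_mult_def)
    also have "\<dots> = axis j 1"
      using someI_ex[OF inv[OF that, unfolded invertible_def], folded matrix_inv_def] by (auto simp: vec_eq_iff column_def mat_def axis_def)
    finally have "column j (matrix_inv (?A x)) =
        (\<chi> k. det (\<chi> r s. if s = k then axis j 1 $ r else ?A x $ r $ s) / det (?A x))"
      using cramer[OF nz[OF that]] by blast
    then have "column j (matrix_inv (?A x)) $ i = ?d x / det (?A x)"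
      by (simp only: vec_lambda_beta)
    then show ?thesis
      by (simp add: column_def)
  qed
qed

text \<open>Both mixed second derivatives are limits of the same second difference
  \<open>(f (x + t u + t v) - f (x + t u) - f (x + t v) + f x) / t\<^sup>2\<close>: two applications of the mean value
  theorem turn this quotient into the derivative, first along \<open>u\<close> and then along \<open>v\<close>, at a point close
  to \<open>x\<close>.\<close>

lemma second_difference_mean_value:
  fixes f :: "'a::real_normed_vector \<Rightarrow> real"
  assumes "smooth_on S f" "t > 0"
    and in_S: "\<And>a b. 0 \<le> a \<Longrightarrow> a \<le> t \<Longrightarrow> 0 \<le> b \<Longrightarrow> b \<le> t \<Longrightarrow> x + a *\<^sub>R u + b *\<^sub>R v \<in> S"
  shows "\<exists>a b. 0 < a \<and> a < t \<and> 0 < b \<and> b < t \<and>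
    f (x + t *\<^sub>R u + t *\<^sub>R v) - f (x + t *\<^sub>R u) - f (x + t *\<^sub>R v) + f x =
    t * t * frechet_derivative (\<lambda>x. frechet_derivative f (at x) u) (at (x + a *\<^sub>R u + b *\<^sub>R v)) v"
proof -
  let ?D = "\<lambda>f x. frechet_derivative f (at x)"
  let ?fu = "\<lambda>x. ?D f x u"
  let ?h = "\<lambda>s. f (x + s *\<^sub>R u + t *\<^sub>R v) - f (x + s *\<^sub>R u + 0 *\<^sub>R v)"
  have der_u: "((\<lambda>s. f (x + s *\<^sub>R u + b *\<^sub>R v)) has_derivative (\<lambda>r. r * ?fu (x + s *\<^sub>R u + b *\<^sub>R v)))
      (at s within X)" if "0 \<le> s" "s \<le> t" "0 \<le> b" "b \<le> t" for s b X
  proof -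
    have f: "(f has_derivative ?D f (x + s *\<^sub>R u + b *\<^sub>R v)) (at (x + s *\<^sub>R u + b *\<^sub>R v))"
      using smooth_on_imp_has_derivative[OF assms(1) in_S[OF that]] .
    have "((\<lambda>s. x + s *\<^sub>R u + b *\<^sub>R v) has_derivative (\<lambda>r. r *\<^sub>R u)) (at s within X)"
      by (auto intro!: derivative_eq_intros)
    from has_derivative_compose[OF this f] linear_cmul[OF has_derivative_linear[OF f]]
    show ?thesis by (simp add: o_def)
  qed
  have "\<exists>a\<in>{0<..<t}. ?h t - ?h 0 =
      (\<lambda>r. r * ?fu (x + a *\<^sub>R u + t *\<^sub>R v) - r * ?fu (x + a *\<^sub>R u + 0 *\<^sub>R v)) (t - 0)"
    using \<open>t > 0\<close> by (intro mvt_simple has_derivative_diff der_u) auto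
  then obtain a where a: "0 < a" "a < t"
    and 1: "?h t - ?h 0 = t * (?fu (x + a *\<^sub>R u + t *\<^sub>R v) - ?fu (x + a *\<^sub>R u + 0 *\<^sub>R v))"
    by (auto simp: algebra_simps)
  have "\<exists>b\<in>{0<..<t}. ?fu (x + a *\<^sub>R u + t *\<^sub>R v) - ?fu (x + a *\<^sub>R u + 0 *\<^sub>R v) =
      (\<lambda>r. r * ?D ?fu (x + a *\<^sub>R u + b *\<^sub>R v) v) (t - 0)"
  proof (intro mvt_simple)
    fix b assume b: "0 \<le> b" "b \<le> t"
    have fu: "(?fu has_derivative ?D ?fu (x + a *\<^sub>R u + b *\<^sub>R v)) (at (x + a *\<^sub>R u + b *\<^sub>R v))"
      using smooth_on_imp_has_derivative[OF smooth_on_frechet_derivative[OF assms(1)] in_S] a b by simp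
    have "((\<lambda>s. x + a *\<^sub>R u + s *\<^sub>R v) has_derivative (\<lambda>r. r *\<^sub>R v)) (at b within {0..t})"
      by (auto intro!: derivative_eq_intros)
    from has_derivative_compose[OF this fu] linear_cmul[OF has_derivative_linear[OF fu]]
    show "((\<lambda>s. ?fu (x + a *\<^sub>R u + s *\<^sub>R v)) has_derivative
        (\<lambda>r. r * ?D ?fu (x + a *\<^sub>R u + b *\<^sub>R v) v)) (at b within {0..t})"
      by (simp add: o_def)
  qed (use \<open>t > 0\<close> in auto)
  then obtain b where b: "0 < b" "b < t"
    and 2: "?fu (x + a *\<^sub>R u + t *\<^sub>R v) - ?fu (x + a *\<^sub>R u + 0 *\<^sub>R v) =
      t * ?D ?fu (x + a *\<^sub>R u + b *\<^sub>R v) v"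
    by auto
  show ?thesis
    using a b 1 unfolding 2
    by (intro exI[of _ a] exI[of _ b]) (simp add: mult.assoc)
qed

lemma symmetric_second_derivative:
  fixes f :: "'a::real_normed_vector \<Rightarrow> real"
  assumes "open S" "smooth_on S f" "x \<in> S"
  shows "frechet_derivative (\<lambda>x. frechet_derivative f (at x) u) (at x) v =
    frechet_derivative (\<lambda>x. frechet_derivative f (at x) v) (at x) u" (is "?uv x = ?vu x")
proof (rule ccontr)
  assume neq: "?uv x \<noteq> ?vu x"
  \<comment> \<open>Both mixed derivatives stay within \<open>e\<close> of their values at \<open>x\<close> on the ball of radius \<open>d\<close>, and
    \<open>t\<close> is so small that the parallelogram spanned by \<open>t u\<close> and \<open>t v\<close> lies in that ball.\<close>
  define e where "e = \<bar>?uv x - ?vu x\<bar> / 2"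
  have "e > 0"
    using neq by (simp add: e_def)
  have cont: "continuous_on S (\<lambda>x. frechet_derivative (\<lambda>x. frechet_derivative f (at x) p) (at x) q)"
    for p q
    using smooth_on_frechet_derivative[OF smooth_on_frechet_derivative[OF assms(2)]]
    by (metis Ck_on.simps(1) smooth_on_def)
  obtain d1 where d1: "d1 > 0" "\<And>y. y \<in> S \<Longrightarrow> dist y x < d1 \<Longrightarrow> dist (?uv y) (?uv x) < e"
    using cont[of u v] \<open>x \<in> S\<close> \<open>e > 0\<close> unfolding continuous_on_iff by blast
  obtain d2 where d2: "d2 > 0" "\<And>y. y \<in> S \<Longrightarrow> dist y x < d2 \<Longrightarrow> dist (?vu y) (?vu x) < e"
    using cont[of v u] \<open>x \<in> S\<close> \<open>e > 0\<close> unfolding continuous_on_iff by blast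
  obtain d3 where d3: "d3 > 0" "ball x d3 \<subseteq> S"
    using assms(1,3) open_contains_ball by blast
  define d where "d = min d1 (min d2 d3)"
  define t where "t = d / (norm u + norm v + 1)"
  have nn: "norm u + norm v + 1 > 0"
    using norm_ge_zero[of u] norm_ge_zero[of v] by linarith
  have "d > 0"
    using d1(1) d2(1) d3(1) by (simp add: d_def)
  then have "t > 0"
    using nn by (simp add: t_def)
  have near: "dist (x + a *\<^sub>R p + b *\<^sub>R q) x < d"
    if "0 \<le> a" "a \<le> t" "0 \<le> b" "b \<le> t" "{p, q} = {u, v}" for a b p q
  proof -
    have "dist (x + a *\<^sub>R p + b *\<^sub>R q) x = norm (a *\<^sub>R p + b *\<^sub>R q)"
      by (simp add: dist_norm add.assoc)
    also have "\<dots> \<le> a * norm p + b * norm q"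
      using norm_triangle_ineq[of "a *\<^sub>R p" "b *\<^sub>R q"] that by simp
    also have "\<dots> \<le> t * norm p + t * norm q"
      using that by (intro add_mono mult_right_mono) auto
    also have "\<dots> = t * (norm u + norm v)"
      using that(5) by (auto simp: doubleton_eq_iff algebra_simps)
    also have "\<dots> < t * (norm u + norm v + 1)"
      using \<open>t > 0\<close> by simp
    also have "\<dots> = d"
      using nn by (simp add: t_def)
    finally show ?thesis .
  qed
  have in_S: "x + a *\<^sub>R p + b *\<^sub>R q \<in> S"
    if "0 \<le> a" "a \<le> t" "0 \<le> b" "b \<le> t" "{p, q} = {u, v}" for a b p q
    using near[OF that] d3(2) by (auto simp: d_def mem_ball dist_commute)
  obtain a b where ab: "0 < a" "a < t" "0 < b" "b < t" and
    1: "f (x + t *\<^sub>R u + t *\<^sub>R v) - f (x + t *\<^sub>R u) - f (x + t *\<^sub>R v) + f x =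
      t * t * ?uv (x + a *\<^sub>R u + b *\<^sub>R v)"
    using second_difference_mean_value[OF assms(2) \<open>t > 0\<close>, of x u v] in_S by blast
  obtain a' b' where ab': "0 < a'" "a' < t" "0 < b'" "b' < t" and
    2: "f (x + t *\<^sub>R v + t *\<^sub>R u) - f (x + t *\<^sub>R v) - f (x + t *\<^sub>R u) + f x =
      t * t * ?vu (x + a' *\<^sub>R v + b' *\<^sub>R u)"
    using second_difference_mean_value[OF assms(2) \<open>t > 0\<close>, of x v u] in_S by blast
  have "x + t *\<^sub>R v + t *\<^sub>R u = x + t *\<^sub>R u + t *\<^sub>R v"
    by simp
  then have "t * t * ?uv (x + a *\<^sub>R u + b *\<^sub>R v) = t * t * ?vu (x + a' *\<^sub>R v + b' *\<^sub>R u)"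
    using 1 2 by (simp add: algebra_simps)
  then have eq: "?uv (x + a *\<^sub>R u + b *\<^sub>R v) = ?vu (x + a' *\<^sub>R v + b' *\<^sub>R u)"
    using \<open>t > 0\<close> by simp
  have "dist (?uv (x + a *\<^sub>R u + b *\<^sub>R v)) (?uv x) < e"
    using near[of a b u v] in_S[of a b u v] ab by (intro d1(2)) (auto simp: d_def)
  moreover have "dist (?vu (x + a' *\<^sub>R v + b' *\<^sub>R u)) (?vu x) < e"
    using near[of a' b' v u] in_S[of a' b' v u] ab' by (intro d2(2)) (auto simp: d_def)
  ultimately show False
    unfolding eq e_def dist_real_def by (simp add: field_simps abs_if split: if_splits)
qed

section \<open>Homogeneous functions on conic domains\<close>

text \<open>The coordinate image of a conic set: the cone acts on the fiber coordinates \<open>y\<close> only.\<close>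

locale conic_domain =
  fixes U :: "'n::finite coords set"
  assumes open_U: "open U"
    and cone: "z \<in> U \<Longrightarrow> r > 0 \<Longrightarrow> (fst z, r *\<^sub>R snd z) \<in> U"
    and nonzero: "z \<in> U \<Longrightarrow> snd z \<noteq> 0"

definition fiber_homogeneous ::
  "'n::finite coords set \<Rightarrow> real \<Rightarrow> ('n coords \<Rightarrow> real) \<Rightarrow> bool" where
  "fiber_homogeneous U \<alpha> f \<longleftrightarrow>
     (\<forall>z\<in>U. \<forall>r>0. f (fst z, r *\<^sub>R snd z) = r powr \<alpha> * f z)"

lemma fiber_homogeneousD:
  "fiber_homogeneous U \<alpha> f \<Longrightarrow> z \<in> U \<Longrightarrow> r > 0 \<Longrightarrow> f (fst z, r *\<^sub>R snd z) = r powr \<alpha> * f z"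
  by (simp add: fiber_homogeneous_def)

lemma fiber_homogeneous_mult:
  assumes "fiber_homogeneous U \<alpha> f" "fiber_homogeneous U \<beta> g" "\<gamma> = \<alpha> + \<beta>"
  shows "fiber_homogeneous U \<gamma> (\<lambda>z. f z * g z)"
  using assms by (simp add: fiber_homogeneous_def powr_add)

lemma fiber_homogeneous_divide:
  assumes "fiber_homogeneous U \<alpha> f" "fiber_homogeneous U \<beta> g" "\<gamma> = \<alpha> - \<beta>"
  shows "fiber_homogeneous U \<gamma> (\<lambda>z. f z / g z)"
  using assms by (simp add: fiber_homogeneous_def powr_diff)

lemma fiber_homogeneous_add:
  "fiber_homogeneous U \<alpha> f \<Longrightarrow> fiber_homogeneous U \<alpha> g \<Longrightarrow> fiber_homogeneous U \<alpha> (\<lambda>z. f z + g z)"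
  by (simp add: fiber_homogeneous_def distrib_left)

lemma fiber_homogeneous_diff:
  "fiber_homogeneous U \<alpha> f \<Longrightarrow> fiber_homogeneous U \<alpha> g \<Longrightarrow> fiber_homogeneous U \<alpha> (\<lambda>z. f z - g z)"
  by (simp add: fiber_homogeneous_def right_diff_distrib)

lemma fiber_homogeneous_cmult:
  "fiber_homogeneous U \<alpha> f \<Longrightarrow> fiber_homogeneous U \<alpha> (\<lambda>z. c * f z)"
  by (simp add: fiber_homogeneous_def)

lemma fiber_homogeneous_sum:
  "(\<And>i. i \<in> I \<Longrightarrow> fiber_homogeneous U \<alpha> (f i)) \<Longrightarrow> fiber_homogeneous U \<alpha> (\<lambda>z. \<Sum>i\<in>I. f i z)"
  by (simp add: fiber_homogeneous_def sum_distrib_left)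

lemma fiber_homogeneous_coord: "fiber_homogeneous U 1 (\<lambda>z. snd z $ k)"
  by (simp add: fiber_homogeneous_def)

lemma dy_eqI: "(f has_derivative f') (at z) \<Longrightarrow> dy i f z = f' (0, axis i 1)"
  using frechet_derivative_at[of f f' z] by (simp add: dy_def)

lemma bounded_linear_coord: "bounded_linear (\<lambda>z :: 'n::finite coords. snd z $ k)"
  using bounded_linear_compose[OF bounded_linear_vec_nth bounded_linear_snd] .

lemma dy_coord: "dy i (\<lambda>z. snd z $ k) z = (if k = i then 1 else 0)"
  by (subst dy_eqI[OF bounded_linear_imp_has_derivative[OF bounded_linear_coord]]) (simp add: axis_def)

lemma fiber_direction_eq_sum: "(0, y) = (\<Sum>a\<in>UNIV. y $ a *\<^sub>R (0, axis a 1 :: real^'n::finite))"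
proof -
  have "y = (\<Sum>a\<in>UNIV. y $ a *\<^sub>R axis a 1)"
    by (simp add: vec_eq_iff axis_def if_distrib cong: if_cong)
  then show ?thesis
    by (simp add: prod_eq_iff fst_sum snd_sum)
qed

lemma derivative_along_fiber:
  assumes "(f has_derivative f') (at z)"
  shows "f' (0, w) = (\<Sum>a\<in>UNIV. w $ a * dy a f z)"
proof -
  interpret linear f'
    using assms by (rule has_derivative_linear)
  show ?thesis
    unfolding fiber_direction_eq_sum[of w] sum scale dy_eqI[OF assms] by simp
qed

context conic_domain
begin

lemmas smooth_intros = smooth_on_sum[OF open_U] smooth_on_mult[OF open_U] smooth_on_add[OF open_U]
  smooth_on_diff[OF open_U] smooth_on_minus[OF open_U] smooth_on_const[OF open_U]

lemma smooth_coord: "smooth_on U (\<lambda>z. snd z $ k)"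
  by (rule smooth_on_linear[OF open_U bounded_linear_coord])

lemma smooth_dy: "smooth_on U f \<Longrightarrow> smooth_on U (dy i f)"
  unfolding dy_def by (rule smooth_on_frechet_derivative)

lemma smooth_dx: "smooth_on U f \<Longrightarrow> smooth_on U (dx i f)"
  unfolding dx_def by (rule smooth_on_frechet_derivative)

lemma dy_commute: "smooth_on U f \<Longrightarrow> z \<in> U \<Longrightarrow> dy i (dy j f) z = dy j (dy i f) z"
  unfolding dy_def by (rule symmetric_second_derivative[OF open_U])

lemma dy_cong:
  assumes "\<And>w. w \<in> U \<Longrightarrow> f w = g w" "z \<in> U"
  shows "dy i f z = dy i g z"
proof -
  have "(f has_derivative f') (at z) \<longleftrightarrow> (g has_derivative f') (at z)" for f'
    using assms has_derivative_transform_within_open[OF _ open_U \<open>z \<in> U\<close>, of f f' UNIV g]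
      has_derivative_transform_within_open[OF _ open_U \<open>z \<in> U\<close>, of g f' UNIV f]
    by auto
  then show ?thesis
    by (simp add: dy_def frechet_derivative_def)
qed

lemma dy_add:
  "smooth_on U f \<Longrightarrow> smooth_on U g \<Longrightarrow> z \<in> U \<Longrightarrow> dy i (\<lambda>z. f z + g z) z = dy i f z + dy i g z"
  unfolding dy_def[of i f] dy_def[of i g]
  by (rule dy_eqI) (intro has_derivative_add smooth_on_imp_has_derivative)

lemma dy_minus: "smooth_on U f \<Longrightarrow> z \<in> U \<Longrightarrow> dy i (\<lambda>z. - f z) z = - dy i f z"
  unfolding dy_def[of i f]
  by (rule dy_eqI) (intro has_derivative_minus smooth_on_imp_has_derivative)

lemma dy_mult:
  "smooth_on U f \<Longrightarrow> smooth_on U g \<Longrightarrow> z \<in> U \<Longrightarrow>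
     dy i (\<lambda>z. f z * g z) z = f z * dy i g z + dy i f z * g z"
  unfolding dy_def[of i f] dy_def[of i g]
  by (rule dy_eqI) (intro has_derivative_mult smooth_on_imp_has_derivative)

lemma dy_cmult: "smooth_on U f \<Longrightarrow> z \<in> U \<Longrightarrow> dy i (\<lambda>z. c * f z) z = c * dy i f z"
  unfolding dy_def[of i f]
  by (rule dy_eqI) (intro has_derivative_mult_right smooth_on_imp_has_derivative)

lemma dy_sum:
  "(\<And>a. a \<in> I \<Longrightarrow> smooth_on U (f a)) \<Longrightarrow> z \<in> U \<Longrightarrow>
     dy i (\<lambda>z. \<Sum>a\<in>I. f a z) z = (\<Sum>a\<in>I. dy i (f a) z)"
  unfolding dy_def[of i "f a" for a]
  by (rule dy_eqI) (intro has_derivative_sum smooth_on_imp_has_derivative)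

lemma dy_mult_coord:
  "smooth_on U f \<Longrightarrow> z \<in> U \<Longrightarrow>
     dy i (\<lambda>z. f z * snd z $ k) z = dy i f z * snd z $ k + (if k = i then f z else 0)"
  by (simp add: dy_mult smooth_coord dy_coord)

lemma dy_contraction:
  assumes "\<And>a. smooth_on U (f a)" "z \<in> U"
  shows "dy i (\<lambda>z. \<Sum>a\<in>UNIV. f a z * snd z $ a) z = (\<Sum>a\<in>UNIV. dy i (f a) z * snd z $ a) + f i z"
  using assms by (subst dy_sum) (auto intro!: smooth_intros smooth_coord simp: dy_mult_coord sum.distrib)

text \<open>Differentiate \<open>f (x, r y) = r\<^sup>\<alpha> f (x, y)\<close> with respect to \<open>r\<close> at \<open>r = 1\<close>.\<close>

lemma euler:
  assumes "smooth_on U f" "fiber_homogeneous U \<alpha> f" "z \<in> U"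
  shows "(\<Sum>a\<in>UNIV. dy a f z * snd z $ a) = \<alpha> * f z"
proof -
  have f: "(f has_derivative frechet_derivative f (at z)) (at z)"
    using assms smooth_on_imp_has_derivative by blast
  have "((\<lambda>r. (fst z, r *\<^sub>R snd z)) has_derivative (\<lambda>h. (0, h *\<^sub>R snd z))) (at 1)"
    by (auto intro!: derivative_eq_intros)
  with f have "((\<lambda>r. f (fst z, r *\<^sub>R snd z)) has_derivative (\<lambda>h. frechet_derivative f (at z) (0, h *\<^sub>R snd z))) (at 1)"
    using has_derivative_compose[of "\<lambda>r. (fst z, r *\<^sub>R snd z)" "\<lambda>h. (0, h *\<^sub>R snd z)" 1 UNIV f
        "frechet_derivative f (at z)"] by (simp add: o_def)
  then have 1: "((\<lambda>r. r powr \<alpha> * f z) has_derivative (\<lambda>h. frechet_derivative f (at z) (0, h *\<^sub>R snd z))) (at 1)"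
    by (rule has_derivative_transform_within_open[OF _ open_greaterThan[of 0]])
       (auto simp: fiber_homogeneousD[OF assms(2,3)])
  have "((\<lambda>r. r powr \<alpha> * f z) has_derivative (\<lambda>h. h * (\<alpha> * f z))) (at (1::real))"
    by (auto intro!: derivative_eq_intros)
  from has_derivative_unique[OF 1 this] have "frechet_derivative f (at z) (0, 1 *\<^sub>R snd z) = 1 * (\<alpha> * f z)"
    by (rule fun_cong)
  then show ?thesis
    using derivative_along_fiber[OF f, of "snd z"] by (simp add: mult.commute)
qed

text \<open>Differentiate \<open>f (x, r y) = r\<^sup>\<alpha> f (x, y)\<close> with respect to \<open>y\<^sup>i\<close>; the chain rule yields a factor
  \<open>r\<close> on the left.\<close>

lemma dy_homogeneous:
  assumes "smooth_on U f" "fiber_homogeneous U \<alpha> f"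
  shows "fiber_homogeneous U (\<alpha> - 1) (dy i f)"
  unfolding fiber_homogeneous_def
proof (intro ballI allI impI)
  fix z :: "'n coords" and r :: real
  assume z: "z \<in> U" and r: "r > 0"
  let ?s = "\<lambda>w :: 'n coords. (fst w, r *\<^sub>R snd w)"
  have f: "(f has_derivative frechet_derivative f (at w)) (at w)" if "w \<in> U" for w
    using assms that smooth_on_imp_has_derivative by blast
  have "(?s has_derivative ?s) (at z)"
    by (auto intro!: derivative_eq_intros)
  with f[OF cone[OF z r]]
  have "((\<lambda>w. f (?s w)) has_derivative (\<lambda>h. frechet_derivative f (at (?s z)) (?s h))) (at z)"
    using has_derivative_compose[of ?s ?s z UNIV f "frechet_derivative f (at (?s z))"] by (simp add: o_def)
  then have 1: "((\<lambda>w. r powr \<alpha> * f w) has_derivative (\<lambda>h. frechet_derivative f (at (?s z)) (?s h))) (at z)"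
    by (rule has_derivative_transform_within_open[OF _ open_U z]) (simp add: fiber_homogeneousD[OF assms(2)] r)
  have "((\<lambda>w. r powr \<alpha> * f w) has_derivative (\<lambda>h. r powr \<alpha> * frechet_derivative f (at z) h)) (at z)"
    using f[OF z] by (rule has_derivative_mult_right)
  from has_derivative_unique[OF 1 this]
  have "frechet_derivative f (at (?s z)) (?s (0, axis i 1)) =
      r powr \<alpha> * frechet_derivative f (at z) (0, axis i 1)"
    by (rule fun_cong)
  then have "frechet_derivative f (at (?s z)) (0, r *\<^sub>R axis i 1) = r powr \<alpha> * dy i f z"
    by (simp add: dy_def)
  moreover have "frechet_derivative f (at (?s z)) (0, r *\<^sub>R axis i 1) = r * dy i f (?s z)"
    using derivative_along_fiber[OF f[OF cone[OF z r]], of "r *\<^sub>R axis i 1"]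
    by (simp add: axis_def if_distrib[of "\<lambda>x. _ * x"] if_distrib[of "\<lambda>x. x * _"] cong: if_cong)
  ultimately show "dy i f (?s z) = r powr (\<alpha> - 1) * dy i f z"
    using r by (simp add: powr_diff field_simps)
qed

end

section \<open>Contracted torsion\<close>

definition contracted_torsion ::
  "('n::finite \<Rightarrow> 'n \<Rightarrow> 'n coords \<Rightarrow> real) \<Rightarrow> 'n \<Rightarrow> 'n \<Rightarrow> 'n coords \<Rightarrow> real" where
  "contracted_torsion J j i z = (\<Sum>a\<in>UNIV. (dy a (J j i) z - dy i (J j a) z) * snd z $ a)"

text \<open>If \<open>T\<^sup>j\<^sub>i = B\<^sub>i y\<^sup>j - B\<^sub>0 \<delta>\<^sup>j\<^sub>i\<close> with \<open>B\<^sub>0 = B\<^sub>b y\<^sup>b\<close>, then \<open>torsion_trace\<close> is \<open>B\<^sub>0\<close> and \<open>torsion_form\<close> is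
  \<open>B\<close> (lemma \<open>torsion_trace_form_eq\<close>). Both are built from the contracted torsion alone, so that their
  smoothness, homogeneity and transformation behaviour are inherited from \<open>J\<close>.\<close>

definition torsion_trace ::
  "('n::finite \<Rightarrow> 'n \<Rightarrow> 'n coords \<Rightarrow> real) \<Rightarrow> 'n coords \<Rightarrow> real" where
  "torsion_trace J z = - (\<Sum>i\<in>UNIV. contracted_torsion J i i z) / (real CARD('n) - 1)"

definition torsion_form ::
  "('n::finite \<Rightarrow> 'n \<Rightarrow> 'n coords \<Rightarrow> real) \<Rightarrow> 'n \<Rightarrow> 'n coords \<Rightarrow> real" where
  "torsion_form J i z =
     (\<Sum>j\<in>UNIV. (contracted_torsion J j i z + (if j = i then 1 else 0) * torsion_trace J z) * snd z $ j)
       / (\<Sum>j\<in>UNIV. snd z $ j * snd z $ j)"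

definition symmetrizer ::
  "('n::finite \<Rightarrow> 'n \<Rightarrow> 'n coords \<Rightarrow> real) \<Rightarrow> 'n \<Rightarrow> 'n coords \<Rightarrow> real" where
  "symmetrizer J i z = - (1/2) * (torsion_form J i z + dy i (torsion_trace J) z)"

text \<open>The components of \<open>J + Q \<otimes> \<C>\<close>.\<close>

definition shift ::
  "('n::finite \<Rightarrow> 'n \<Rightarrow> 'n coords \<Rightarrow> real) \<Rightarrow> ('n \<Rightarrow> 'n coords \<Rightarrow> real) \<Rightarrow>
     'n \<Rightarrow> 'n \<Rightarrow> 'n coords \<Rightarrow> real" where
  "shift J Q k i z = J k i z + Q i z * snd z $ k"

lemma norm_square_eq_0_iff: "(\<Sum>j\<in>UNIV. y $ j * y $ j) = 0 \<longleftrightarrow> y = (0 :: real^'n::finite)"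
  using inner_eq_zero_iff[of y] by (simp add: inner_vec_def)

context conic_domain
begin

lemma smooth_contracted_torsion:
  "(\<And>k i. smooth_on U (J k i)) \<Longrightarrow> smooth_on U (contracted_torsion J j i)"
  unfolding contracted_torsion_def by (intro smooth_intros smooth_dy smooth_coord)

lemma homogeneous_contracted_torsion:
  assumes "\<And>k i. smooth_on U (J k i)" "\<And>k i. fiber_homogeneous U 1 (J k i)"
  shows "fiber_homogeneous U 1 (contracted_torsion J j i)"
  unfolding contracted_torsion_def using dy_homogeneous[OF assms]
  by (intro fiber_homogeneous_sum fiber_homogeneous_mult[where \<alpha> = 0 and \<beta> = 1]
      fiber_homogeneous_coord fiber_homogeneous_diff) auto

lemma smooth_torsion_trace:
  assumes "\<And>k i. smooth_on U (J k i)"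
  shows "smooth_on U (torsion_trace J)"
proof -
  have "smooth_on U (\<lambda>z. - inverse (real CARD('n) - 1) * (\<Sum>i\<in>UNIV. contracted_torsion J i i z))"
    by (intro smooth_intros smooth_contracted_torsion assms)
  then show ?thesis
    unfolding torsion_trace_def by (simp add: divide_inverse mult.commute)
qed

lemma homogeneous_torsion_trace:
  assumes "\<And>k i. smooth_on U (J k i)" "\<And>k i. fiber_homogeneous U 1 (J k i)"
  shows "fiber_homogeneous U 1 (torsion_trace J)"
proof -
  have "fiber_homogeneous U 1
      (\<lambda>z. - inverse (real CARD('n) - 1) * (\<Sum>i\<in>UNIV. contracted_torsion J i i z))"
    by (intro fiber_homogeneous_cmult fiber_homogeneous_sum homogeneous_contracted_torsion assms)
  then show ?thesis
    unfolding torsion_trace_def by (simp add: divide_inverse mult.commute)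
qed

lemma smooth_symmetrizer:
  assumes "\<And>k i. smooth_on U (J k i)"
  shows "smooth_on U (symmetrizer J i)"
  unfolding symmetrizer_def torsion_form_def
  by (intro smooth_intros smooth_on_divide[OF open_U] smooth_contracted_torsion smooth_torsion_trace
      smooth_dy smooth_coord assms)
     (simp add: norm_square_eq_0_iff nonzero)

lemma homogeneous_symmetrizer:
  assumes "\<And>k i. smooth_on U (J k i)" "\<And>k i. fiber_homogeneous U 1 (J k i)"
  shows "fiber_homogeneous U 0 (symmetrizer J i)"
proof -
  have "fiber_homogeneous U 0 (torsion_form J i)"
    unfolding torsion_form_def
    by (intro fiber_homogeneous_divide[where \<alpha> = 2 and \<beta> = 2] fiber_homogeneous_sum
        fiber_homogeneous_mult[where \<alpha> = 1 and \<beta> = 1] fiber_homogeneous_coord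
        fiber_homogeneous_add fiber_homogeneous_cmult homogeneous_contracted_torsion
        homogeneous_torsion_trace assms) auto
  moreover have "fiber_homogeneous U 0 (dy i (torsion_trace J))"
    using dy_homogeneous[OF smooth_torsion_trace homogeneous_torsion_trace] assms by fastforce
  ultimately show ?thesis
    unfolding symmetrizer_def by (intro fiber_homogeneous_cmult fiber_homogeneous_add)
qed

text \<open>By Euler's theorem \<open>J\<^sup>j\<^sub>i\<^sub>\<cdot>\<^sub>a y\<^sup>a = J\<^sup>j\<^sub>i\<close>, and \<open>J\<^sup>j\<^sub>a\<^sub>\<cdot>\<^sub>i y\<^sup>a\<close> differs from the derivative of
  \<open>J\<^sup>j\<^sub>a y\<^sup>a\<close> by another \<open>J\<^sup>j\<^sub>i\<close>.\<close>

lemma contracted_torsion_eq: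
  assumes "\<And>k i. smooth_on U (J k i)" "\<And>k i. fiber_homogeneous U 1 (J k i)" "z \<in> U"
  shows "contracted_torsion J j i z = 2 * J j i z - dy i (\<lambda>z. \<Sum>a\<in>UNIV. J j a z * snd z $ a) z"
  using dy_contraction[of "J j", OF assms(1,3)] euler[OF assms, of j i]
  by (simp add: contracted_torsion_def left_diff_distrib sum_subtractf)

text \<open>A vanishing contracted torsion makes \<open>J\<^sup>j\<^sub>i\<close> half the derivative of \<open>J\<^sup>j\<^sub>a y\<^sup>a\<close> along \<open>y\<^sup>i\<close>, so the
  claim is the symmetry of second derivatives.\<close>

lemma torsion_free_imp_symmetric:
  assumes J: "\<And>k i. smooth_on U (J k i)" "\<And>k i. fiber_homogeneous U 1 (J k i)"
    and free: "\<And>z j i. z \<in> U \<Longrightarrow> contracted_torsion J j i z = 0" and z: "z \<in> U"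
  shows "dy k (J j i) z = dy i (J j k) z"
proof -
  let ?S = "\<lambda>z. \<Sum>a\<in>UNIV. J j a z * snd z $ a"
  have S: "smooth_on U ?S"
    by (intro smooth_intros smooth_coord J)
  have J_eq: "J j i w = 1/2 * dy i ?S w" if "w \<in> U" for w i
    using contracted_torsion_eq[of J w j i, OF J that] free[OF that, of j i] by simp
  have "dy k (J j i) z = 1/2 * dy k (dy i ?S) z" "dy i (J j k) z = 1/2 * dy i (dy k ?S) z"
    unfolding dy_cmult[OF smooth_dy[OF S] z, symmetric]
    by (rule dy_cong[OF J_eq z], assumption)+
  then show ?thesis
    using dy_commute[OF S z, of k i] by simp
qed

lemma contracted_torsion_shift:
  assumes J: "\<And>k i. smooth_on U (J k i)" and Q: "\<And>i. smooth_on U (Q i)"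
    "\<And>i. fiber_homogeneous U 0 (Q i)" and z: "z \<in> U"
  shows "contracted_torsion (shift J Q) j i z = contracted_torsion J j i z
    + (2 * Q i z - dy i (\<lambda>z. \<Sum>a\<in>UNIV. Q a z * snd z $ a) z) * snd z $ j
    - (if j = i then 1 else 0) * (\<Sum>a\<in>UNIV. Q a z * snd z $ a)"
proof -
  have dy_shift: "dy a (shift J Q k b) z =
      dy a (J k b) z + dy a (Q b) z * snd z $ k + (if k = a then Q b z else 0)" for a k b
    unfolding shift_def by (simp add: dy_add J Q z dy_mult_coord smooth_intros smooth_coord)
  have 0: "(\<Sum>a\<in>UNIV. dy a (Q i) z * snd z $ a) = 0"
    using euler[OF Q z, of i] by simp
  have "contracted_torsion (shift J Q) j i z = contracted_torsion J j i z
      + (\<Sum>a\<in>UNIV. dy a (Q i) z * snd z $ a) * snd z $ j + Q i z * snd z $ j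
      - (\<Sum>a\<in>UNIV. dy i (Q a) z * snd z $ a) * snd z $ j
      - (if j = i then 1 else 0) * (\<Sum>a\<in>UNIV. Q a z * snd z $ a)"
  proof -
    have "(dy a (shift J Q j i) z - dy i (shift J Q j a) z) * snd z $ a =
        (dy a (J j i) z - dy i (J j a) z) * snd z $ a + dy a (Q i) z * snd z $ a * snd z $ j
        + (if a = j then Q i z * snd z $ j else 0) - dy i (Q a) z * snd z $ a * snd z $ j
        - (if j = i then 1 else 0) * (Q a z * snd z $ a)" for a
      unfolding dy_shift by (simp add: algebra_simps)
    then show ?thesis
      by (simp only: contracted_torsion_def[of "shift J Q"] sum.distrib sum_subtractf
          sum_distrib_left[symmetric] sum_distrib_right[symmetric] sum.delta finite UNIV_I if_True)
         (simp only: contracted_torsion_def)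
  qed
  then show ?thesis
    unfolding 0 dy_contraction[of Q, OF Q(1) z] by (simp add: algebra_simps)
qed

lemma torsion_trace_form_eq:
  assumes "CARD('n) \<ge> 2" "z \<in> U"
    and T: "\<And>j i. contracted_torsion J j i z =
      B i * snd z $ j - (if j = i then 1 else 0) * (\<Sum>b\<in>UNIV. B b * snd z $ b)"
  shows "torsion_trace J z = (\<Sum>b\<in>UNIV. B b * snd z $ b)" "torsion_form J i z = B i"
proof -
  have "(\<Sum>i\<in>UNIV. contracted_torsion J i i z) =
      - (real CARD('n) - 1) * (\<Sum>b\<in>UNIV. B b * snd z $ b)"
    unfolding T by (simp add: sum_subtractf algebra_simps)
  then show 1: "torsion_trace J z = (\<Sum>b\<in>UNIV. B b * snd z $ b)"
    using assms(1) by (simp add: torsion_trace_def field_simps)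
  have "torsion_form J i z =
      (B i * (\<Sum>j\<in>UNIV. snd z $ j * snd z $ j)) / (\<Sum>j\<in>UNIV. snd z $ j * snd z $ j)"
    unfolding torsion_form_def T 1 sum_distrib_left by (simp add: mult.assoc)
  then show "torsion_form J i z = B i"
    using nonzero[OF \<open>z \<in> U\<close>] by (simp add: norm_square_eq_0_iff)
qed

text \<open>With \<open>Q\<^sub>i = - (B\<^sub>i + B\<^sub>0\<^sub>\<cdot>\<^sub>i) / 2\<close> Euler's theorem gives \<open>Q\<^sub>0 = - B\<^sub>0\<close>, hence
  \<open>2 Q\<^sub>i - Q\<^sub>0\<^sub>\<cdot>\<^sub>i = - B\<^sub>i\<close>, and the correction computed in \<open>contracted_torsion_shift\<close> is exactly
  \<open>- (B\<^sub>i y\<^sup>j - B\<^sub>0 \<delta>\<^sup>j\<^sub>i)\<close>.\<close>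

lemma symmetrizer_removes_torsion:
  assumes card: "CARD('n) \<ge> 2"
    and J: "\<And>k i. smooth_on U (J k i)" "\<And>k i. fiber_homogeneous U 1 (J k i)"
    and T: "\<And>z j i. z \<in> U \<Longrightarrow> contracted_torsion J j i z =
      B i z * snd z $ j - (if j = i then 1 else 0) * (\<Sum>b\<in>UNIV. B b z * snd z $ b)"
    and z: "z \<in> U"
  shows "contracted_torsion (shift J (symmetrizer J)) j i z = 0"
proof -
  let ?Q0 = "\<lambda>z. \<Sum>a\<in>UNIV. symmetrizer J a z * snd z $ a"
  note trace = torsion_trace_form_eq(1)[OF card _ T] and form = torsion_trace_form_eq(2)[OF card _ T]
  have Q0: "?Q0 w = - torsion_trace J w" if w: "w \<in> U" for w
  proof -
    have "?Q0 w = - (1/2) * ((\<Sum>a\<in>UNIV. torsion_form J a w * snd w $ a)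
        + (\<Sum>a\<in>UNIV. dy a (torsion_trace J) w * snd w $ a))"
      unfolding symmetrizer_def sum.distrib[symmetric] sum_distrib_left
      by (intro sum.cong) (simp_all add: algebra_simps)
    also have "\<dots> = - torsion_trace J w"
      using euler[OF smooth_torsion_trace[OF J(1)] homogeneous_torsion_trace[OF J] w]
      by (simp add: form[OF w w] trace[OF w w])
    finally show ?thesis .
  qed
  have dQ0: "dy i ?Q0 z = - dy i (torsion_trace J) z"
    using dy_cong[OF Q0 z] dy_minus[OF smooth_torsion_trace[OF J(1)] z] by simp
  show ?thesis
    unfolding contracted_torsion_shift[OF J(1) smooth_symmetrizer[OF J(1)] homogeneous_symmetrizer[OF J] z]
      dQ0 Q0[OF z] T[OF z] trace[OF z z]
    by (simp add: symmetrizer_def form[OF z z] algebra_simps)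
qed

end

text \<open>The matrix \<open>B\<^sub>i y\<^sup>j\<close> has rank at most one, so in dimension at least two it is a multiple of the
  identity only if it vanishes; then \<open>B\<close> vanishes because \<open>y\<close> does not.\<close>

lemma vector_tensor_eq_scalar_identity:
  fixes y :: "real^'n::finite" and B :: "'n \<Rightarrow> real"
  assumes card: "CARD('n) \<ge> 2" and y: "y \<noteq> 0"
    and eq: "\<And>j i. B i * y $ j = (if j = i then 1 else 0) * b"
  shows "b = 0" "B i = 0"
proof -
  obtain k where k: "y $ k \<noteq> 0"
    using y by (auto simp: vec_eq_iff)
  have "card (UNIV - {k}) > 0"
    using card by (simp add: card_Diff_singleton)
  then have "UNIV - {k} \<noteq> {}"
    using card_gt_0_iff by blast
  then obtain l where "l \<noteq> k"
    by blast
  then have "B l = 0"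
    using eq[of l k] k by simp
  then show "b = 0"
    using eq[of l l] by simp
  then show "B i = 0"
    using eq[of i k] k by simp
qed

context conic_domain
begin

text \<open>The uniqueness of the symmetrization. Equal torsions mean \<open>(2 Q\<^sub>i - Q\<^sub>0\<^sub>\<cdot>\<^sub>i) y\<^sup>j = Q\<^sub>0 \<delta>\<^sup>j\<^sub>i\<close> on the whole
  domain; the rank argument gives \<open>Q\<^sub>0 = 0\<close> there, hence \<open>Q\<^sub>0\<^sub>\<cdot>\<^sub>i = 0\<close>, and the other half of the rank
  argument becomes \<open>2 Q\<^sub>i = 0\<close>.\<close>

lemma contracted_torsion_shift_inj:
  assumes card: "CARD('n) \<ge> 2" and J: "\<And>k i. smooth_on U (J k i)"
    and Q: "\<And>i. smooth_on U (Q i)" "\<And>i. fiber_homogeneous U 0 (Q i)"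
    and eq: "\<And>z j i. z \<in> U \<Longrightarrow> contracted_torsion (shift J Q) j i z = contracted_torsion J j i z"
    and z: "z \<in> U"
  shows "Q i z = 0"
proof -
  let ?Q0 = "\<lambda>z. \<Sum>a\<in>UNIV. Q a z * snd z $ a"
  have rel: "(2 * Q i w - dy i ?Q0 w) * snd w $ j = (if j = i then 1 else 0) * ?Q0 w"
    if "w \<in> U" for w i j
    using contracted_torsion_shift[of J Q w j i, OF J Q that] eq[OF that, of j i] by linarith
  have Q0: "?Q0 w = 0" if w: "w \<in> U" for w
    by (rule vector_tensor_eq_scalar_identity(1)[OF card nonzero[OF w] rel[OF w]])
  have "dy i ?Q0 z = dy i (\<lambda>z. 0) z"
    by (rule dy_cong[OF Q0 z])
  moreover have "2 * Q i z - dy i ?Q0 z = 0"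
    by (rule vector_tensor_eq_scalar_identity(2)[OF card nonzero[OF z] rel[OF z]])
  ultimately show ?thesis
    by (simp add: dy_def)
qed

end

section \<open>The affine equation in a chart\<close>

locale conic_metric = conic_domain U for U :: "'n::finite coords set" +
  fixes l :: "'n coords \<Rightarrow> real"
  assumes smooth_l: "smooth_on U l"
    and homogeneous_l: "fiber_homogeneous U 2 l"
    and l_nonzero: "z \<in> U \<Longrightarrow> l z \<noteq> 0"
    and fund_invertible: "z \<in> U \<Longrightarrow> invertible (\<chi> i j. fund l i j z)"
begin

lemma smooth_fund: "smooth_on U (fund l i j)"
  unfolding fund_def by (intro smooth_intros smooth_dy smooth_l)

lemma homogeneous_fund: "fiber_homogeneous U 0 (fund l i j)"
proof -
  have "fiber_homogeneous U (2 - 1 - 1) (dy j (dy i l))"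
    by (intro dy_homogeneous smooth_dy smooth_l homogeneous_l)
  then have "fiber_homogeneous U 0 (dy j (dy i l))"
    by simp
  then show ?thesis
    unfolding fund_def by (rule fiber_homogeneous_cmult)
qed

lemma smooth_fund_inv: "smooth_on U (fund_inv l i j)"
  unfolding fund_inv_def by (intro smooth_on_matrix_inv open_U smooth_fund fund_invertible)

lemma smooth_spray: "smooth_on U (spray l k)"
  unfolding spray_def by (intro smooth_intros smooth_fund_inv smooth_dx smooth_fund smooth_coord)

lemma berwald_symmetric: "z \<in> U \<Longrightarrow> dy j (berwald l k i) z = dy i (berwald l k j) z"
  unfolding berwald_def by (rule dy_commute[OF smooth_spray])

lemma smooth_berwald: "smooth_on U (berwald l k i)"
  unfolding berwald_def by (rule smooth_dy[OF smooth_spray])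

text \<open>This is \<open>y\<^sub>a y\<^sup>a = L\<close>, from Euler's theorem for \<open>L\<close> and its first derivatives.\<close>

lemma lower_y_contraction:
  assumes z: "z \<in> U"
  shows "(\<Sum>a\<in>UNIV. lower_y l a z / l z * snd z $ a) = 1"
proof -
  have lower: "lower_y l a z = 1/2 * dy a l z" for a
    using euler[OF smooth_dy[OF smooth_l] dy_homogeneous[OF smooth_l homogeneous_l] z, of a]
    by (simp add: lower_y_def fund_def sum_divide_distrib[symmetric])
  have "(\<Sum>a\<in>UNIV. lower_y l a z / l z * snd z $ a) =
      1 / (2 * l z) * (\<Sum>a\<in>UNIV. dy a l z * snd z $ a)"
    unfolding lower sum_distrib_left by simp
  then show ?thesis
    using euler[OF smooth_l homogeneous_l z] l_nonzero[OF z] by simp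
qed

text \<open>The components of the fundamental tensor are \<open>0\<close>-homogeneous, so \<open>g\<^sub>a\<^sub>b\<^sub>\<cdot>\<^sub>i y\<^sup>i = 0\<close>.\<close>

lemma mean_cartan_contraction:
  assumes z: "z \<in> U"
  shows "(\<Sum>i\<in>UNIV. mean_cartan l i z * snd z $ i) = 0"
proof -
  have "(\<Sum>i\<in>UNIV. mean_cartan l i z * snd z $ i) =
      (\<Sum>i\<in>UNIV. \<Sum>a\<in>UNIV. \<Sum>b\<in>UNIV.
        fund_inv l a b z * (1/2) * (dy i (fund l a b) z * snd z $ i))"
    by (simp add: mean_cartan_def cartan_def sum_distrib_right mult.assoc)
  also have "\<dots> = (\<Sum>a\<in>UNIV. \<Sum>i\<in>UNIV. \<Sum>b\<in>UNIV.
        fund_inv l a b z * (1/2) * (dy i (fund l a b) z * snd z $ i))"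
    by (rule sum.swap)
  also have "\<dots> = (\<Sum>a\<in>UNIV. \<Sum>b\<in>UNIV. \<Sum>i\<in>UNIV.
        fund_inv l a b z * (1/2) * (dy i (fund l a b) z * snd z $ i))"
    by (intro sum.cong refl sum.swap)
  also have "\<dots> = (\<Sum>a\<in>UNIV. \<Sum>b\<in>UNIV.
        fund_inv l a b z * (1/2) * (\<Sum>i\<in>UNIV. dy i (fund l a b) z * snd z $ i))"
    by (simp only: sum_distrib_left)
  finally show ?thesis
    using euler[OF smooth_fund homogeneous_fund z] by simp
qed

text \<open>Adding \<open>Q \<otimes> \<C>\<close> contributes \<open>(n + 2) Q\<^sub>b\<close> through the metric term, nothing through the Cartan term
  and \<open>- (n Q\<^sub>b + Q\<^sub>0\<^sub>\<cdot>\<^sub>b)\<close> through the divergence terms.\<close>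

lemma affine_brace_shift:
  assumes J: "\<And>k i. smooth_on U (J k i)" and Q: "\<And>i. smooth_on U (Q i)"
    "\<And>i. fiber_homogeneous U 0 (Q i)" and z: "z \<in> U"
  shows "affine_brace l (shift J Q) b z = affine_brace l J b z
    + (2 * Q b z - dy b (\<lambda>z. \<Sum>a\<in>UNIV. Q a z * snd z $ a) z)"
proof -
  have dy_shift: "dy a (shift J Q k b) z =
      dy a (J k b) z + dy a (Q b) z * snd z $ k + (if k = a then Q b z else 0)" for a k b
    unfolding shift_def by (simp add: dy_add J Q z dy_mult_coord smooth_intros smooth_coord)
  have metric: "(\<Sum>a\<in>UNIV. lower_y l a z / l z * shift J Q a b z) =
      (\<Sum>a\<in>UNIV. lower_y l a z / l z * J a b z) + Q b z"
  proof -
    have "lower_y l a z / l z * shift J Q a b z =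
        lower_y l a z / l z * J a b z + Q b z * (lower_y l a z / l z * snd z $ a)" for a
      by (simp add: shift_def algebra_simps)
    then show ?thesis
      by (simp only: sum.distrib sum_distrib_left[symmetric] lower_y_contraction[OF z])
  qed
  have cartan: "(\<Sum>a\<in>UNIV. mean_cartan l a z * shift J Q a b z) =
      (\<Sum>a\<in>UNIV. mean_cartan l a z * J a b z)"
  proof -
    have "mean_cartan l a z * shift J Q a b z =
        mean_cartan l a z * J a b z + Q b z * (mean_cartan l a z * snd z $ a)" for a
      by (simp add: shift_def algebra_simps)
    then show ?thesis
      by (simp only: sum.distrib sum_distrib_left[symmetric] mean_cartan_contraction[OF z])
  qed
  have divergence: "(\<Sum>a\<in>UNIV. dy a (shift J Q a b) z + dy b (shift J Q a a) z) =
      (\<Sum>a\<in>UNIV. dy a (J a b) z + dy b (J a a) z) + real CARD('n) * Q b z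
      + dy b (\<lambda>z. \<Sum>a\<in>UNIV. Q a z * snd z $ a) z"
  proof -
    have "dy a (shift J Q a b) z + dy b (shift J Q a a) z =
        (dy a (J a b) z + dy b (J a a) z) + dy a (Q b) z * snd z $ a + Q b z
        + dy b (Q a) z * snd z $ a + (if a = b then Q a z else 0)" for a
      unfolding dy_shift by simp
    then have "(\<Sum>a\<in>UNIV. dy a (shift J Q a b) z + dy b (shift J Q a a) z) =
        (\<Sum>a\<in>UNIV. dy a (J a b) z + dy b (J a a) z) + (\<Sum>a\<in>UNIV. dy a (Q b) z * snd z $ a)
        + real CARD('n) * Q b z + (\<Sum>a\<in>UNIV. dy b (Q a) z * snd z $ a) + Q b z"
      by (simp only: sum.distrib sum.delta finite UNIV_I if_True sum_constant)
    then show ?thesis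
      using euler[OF Q z, of b] dy_contraction[of Q, OF Q(1) z, of b] by simp
  qed
  show ?thesis
    unfolding affine_brace_def metric cartan divergence by (simp add: algebra_simps)
qed

lemma affine_lhs_eq:
  "affine_lhs l J i j z = affine_brace l J i z * snd z $ j
    - (if j = i then 1 else 0) * (\<Sum>b\<in>UNIV. affine_brace l J b z * snd z $ b)
    - contracted_torsion J j i z"
proof -
  have "affine_brace l J b z * ((if b = i then 1 else 0) * snd z $ j - snd z $ b * (if j = i then 1 else 0)) =
      (if b = i then affine_brace l J b z * snd z $ j else 0)
      - (if j = i then 1 else 0) * (affine_brace l J b z * snd z $ b)" for b
    by simp
  then show ?thesis
    by (simp only: affine_lhs_def contracted_torsion_def sum_subtractf sum.delta finite UNIV_I if_True
        sum_distrib_left[symmetric])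
qed

text \<open>The key invariance. By \<open>affine_brace_shift\<close> the first two terms of \<open>affine_lhs_eq\<close> change by
  \<open>(2 Q\<^sub>i - Q\<^sub>0\<^sub>\<cdot>\<^sub>i) y\<^sup>j - (2 Q\<^sub>0 - Q\<^sub>0) \<delta>\<^sup>j\<^sub>i\<close>, which is the change of the contracted torsion.\<close>

lemma affine_lhs_shift:
  assumes J: "\<And>k i. smooth_on U (J k i)" and Q: "\<And>i. smooth_on U (Q i)"
    "\<And>i. fiber_homogeneous U 0 (Q i)" and z: "z \<in> U"
  shows "affine_lhs l (shift J Q) i j z = affine_lhs l J i j z"
proof -
  let ?Q0 = "\<lambda>z. \<Sum>a\<in>UNIV. Q a z * snd z $ a"
  have Q0: "smooth_on U ?Q0" "fiber_homogeneous U 1 ?Q0"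
    by (intro smooth_intros smooth_coord Q)
       (intro fiber_homogeneous_sum fiber_homogeneous_mult[where \<alpha> = 0 and \<beta> = 1]
          fiber_homogeneous_coord Q, simp)
  have "(\<Sum>b\<in>UNIV. affine_brace l (shift J Q) b z * snd z $ b) =
      (\<Sum>b\<in>UNIV. affine_brace l J b z * snd z $ b) + 2 * ?Q0 z - (\<Sum>b\<in>UNIV. dy b ?Q0 z * snd z $ b)"
    unfolding affine_brace_shift[OF J Q z] distrib_right left_diff_distrib sum.distrib sum_subtractf
      sum_distrib_left by (simp add: mult.assoc)
  also have "\<dots> = (\<Sum>b\<in>UNIV. affine_brace l J b z * snd z $ b) + ?Q0 z"
    using euler[OF Q0 z] by simp
  finally show ?thesis
    unfolding affine_lhs_eq contracted_torsion_shift[OF J Q z] affine_brace_shift[OF J Q z]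
    by (simp add: algebra_simps)
qed

lemma affine_lhs_cong:
  assumes "\<And>w k i. w \<in> U \<Longrightarrow> J k i w = J' k i w" "z \<in> U"
  shows "affine_lhs l J i j z = affine_lhs l J' i j z"
proof -
  have "dy a (J k i) z = dy a (J' k i) z" for a k i
    using dy_cong[OF assms(1) \<open>z \<in> U\<close>] .
  then show ?thesis
    using assms by (simp add: affine_lhs_def affine_brace_def)
qed

end

section \<open>Conic open sets of tangent vectors\<close>

locale tangent_cone =
  fixes M :: "'a topology" and \<A> :: "('a, 'n::finite) chart set" and A :: "('a, 'n) tvec set"
  assumes manifold: "smooth_manifold M \<A>" and conic: "open_conic M \<A> A"
begin

text \<open>The pairs of a vector and a chart for which an anisotropic object has components; at all other
  pairs it is zero.\<close>

definition chart_at :: "('a, 'n) chart \<Rightarrow> ('a, 'n) tvec \<Rightarrow> bool" where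
  "chart_at c v \<longleftrightarrow> v \<in> A \<and> c \<in> \<A> \<and> fst v \<in> fst c"

lemma inj_on_chart: "c \<in> \<A> \<Longrightarrow> inj_on (snd c) (fst c)"
proof -
  assume c: "c \<in> \<A>"
  then have "homeomorphic_map (subtopology M (fst c)) (top_of_set (snd c ` fst c)) (snd c)"
    and "openin M (fst c)"
    using manifold by (auto simp: smooth_manifold_def)
  then show ?thesis
    using homeomorphic_imp_injective_map[of "subtopology M (fst c)" _ "snd c"] openin_subset[of M "fst c"]
    by (simp add: Int_absorb1)
qed

lemma tangent: "v \<in> A \<Longrightarrow> v \<in> tangent_bundle \<A>"
  using conic by (auto simp: open_conic_def)

lemma components_transform:
  "chart_at c v \<Longrightarrow> chart_at c' v \<Longrightarrow> snd v c' $ k = (\<Sum>a\<in>UNIV. jac c c' (fst v) k a * snd v c $ a)"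
  using tangent[of v] by (auto simp: chart_at_def tangent_bundle_def split_def)

text \<open>The coordinates fix the base point because charts are injective, and they fix the components in
  every other chart by the transformation law.\<close>

lemma ind_chart_inj:
  assumes "v \<in> tangent_bundle \<A>" "w \<in> tangent_bundle \<A>" "c \<in> \<A>" "fst v \<in> fst c" "fst w \<in> fst c"
    "ind_chart c v = ind_chart c w"
  shows "v = w"
proof -
  obtain p V where v: "v = (p, V)"
    by (cases v)
  obtain q W where w: "w = (q, W)"
    by (cases w)
  have pq: "p = q"
    using inj_onD[OF inj_on_chart[OF \<open>c \<in> \<A>\<close>], of p q] assms by (simp add: v w ind_chart_def)
  have "V c' = W c'" for c'
  proof (cases "c' \<in> \<A> \<and> p \<in> fst c'")
    case True
    have "V c' $ k = W c' $ k" for k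
    proof -
      have "V c' $ k = (\<Sum>a\<in>UNIV. jac c c' p k a * V c $ a)"
        "W c' $ k = (\<Sum>a\<in>UNIV. jac c c' p k a * W c $ a)"
        using assms True pq by (auto simp: v w tangent_bundle_def)
      then show ?thesis
        using assms by (simp add: v w ind_chart_def)
    qed
    then show ?thesis
      by (simp add: vec_eq_iff)
  next
    case False
    have "V c' = 0" "W c' = 0"
      using assms(1,2) False unfolding v w tangent_bundle_def pq by blast+
    then show ?thesis
      by simp
  qed
  then show ?thesis
    using pq by (auto simp: v w)
qed

lemma ind_chart_inv_ind_chart: "chart_at c v \<Longrightarrow> ind_chart_inv \<A> c (ind_chart c v) = v"
  unfolding ind_chart_inv_def chart_at_def
  by (rule inv_into_f_f) (use ind_chart_inj[of _ _ c] in \<open>auto simp: tangent inj_on_def\<close>)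

lemma local_fun_ind_chart: "chart_at c v \<Longrightarrow> local_fun \<A> c F (ind_chart c v) = F v"
  by (simp add: local_fun_def ind_chart_inv_ind_chart)

lemma ind_chart_in_coord_dom: "chart_at c v \<Longrightarrow> ind_chart c v \<in> coord_dom A c"
  by (auto simp: chart_at_def coord_dom_def)

lemma coord_domE:
  assumes "z \<in> coord_dom A c" "c \<in> \<A>"
  obtains v where "chart_at c v" "z = ind_chart c v"
  using assms by (auto simp: chart_at_def coord_dom_def)

lemma snd_ind_chart: "snd (ind_chart c v) = snd v c"
  by (simp add: ind_chart_def)

lemma scale_in: "v \<in> A \<Longrightarrow> r > 0 \<Longrightarrow> scale_tvec r v \<in> A"
  using conic by (simp add: open_conic_def)

lemma fst_scale [simp]: "fst (scale_tvec r v) = fst v"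
  by (simp add: scale_tvec_def)

lemma snd_scale [simp]: "snd (scale_tvec r v) c = r *\<^sub>R snd v c"
  by (simp add: scale_tvec_def)

lemma chart_at_scale: "chart_at c v \<Longrightarrow> r > 0 \<Longrightarrow> chart_at c (scale_tvec r v)"
  by (simp add: chart_at_def scale_in)

lemma ind_chart_scale: "ind_chart c (scale_tvec r v) = (fst (ind_chart c v), r *\<^sub>R snd (ind_chart c v))"
  by (simp add: ind_chart_def)

lemma component_nonzero:
  assumes "chart_at c v"
  shows "snd v c \<noteq> 0"
proof
  assume 0: "snd v c = 0"
  obtain p V where v: "v = (p, V)"
    by (cases v)
  have tv: "v \<in> tangent_bundle \<A>" and vA: "v \<in> A"
    using assms tangent by (auto simp: chart_at_def)
  have p: "p \<in> (\<Union>c\<in>\<A>. fst c)"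
    using tv by (simp add: v tangent_bundle_def)
  then have "(p, \<lambda>_. 0) \<in> tangent_bundle \<A>"
    by (auto simp: tangent_bundle_def)
  then have "v = (p, \<lambda>_. 0)"
    using ind_chart_inj[OF tv, of "(p, \<lambda>_. 0)" c] assms 0 by (simp add: chart_at_def ind_chart_def v)
  then have "v \<in> zero_section \<A>"
    using p by (auto simp: zero_section_def)
  then show False
    using conic vA by (auto simp: open_conic_def)
qed

lemma conic_domain_coord_dom:
  assumes c: "c \<in> \<A>"
  shows "conic_domain (coord_dom A c)"
proof
  show "open (coord_dom A c)"
    using conic c by (simp add: open_conic_def)
  fix z assume "z \<in> coord_dom A c"
  then obtain v where v: "chart_at c v" "z = ind_chart c v"
    using c by (rule coord_domE)
  then show "snd z \<noteq> 0"
    using component_nonzero by (simp add: snd_ind_chart)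
  show "(fst z, r *\<^sub>R snd z) \<in> coord_dom A c" if "r > 0" for r
    using ind_chart_in_coord_dom[OF chart_at_scale[OF v(1) that]] by (simp add: v(2) ind_chart_scale)
qed

text \<open>The fiber of the cone over a point is open: coordinates near those of \<open>v\<close> with the same \<open>x\<close> come from
  vectors over the same point.\<close>

lemma fiber_neighbourhood:
  assumes v: "chart_at c v"
  obtains e where "e > 0"
    "\<And>w. norm w < e \<Longrightarrow> \<exists>u\<in>A. fst u = fst v \<and> snd u c = snd v c + w"
proof -
  have c: "c \<in> \<A>"
    using v by (simp add: chart_at_def)
  obtain e where e: "e > 0" "ball (ind_chart c v) e \<subseteq> coord_dom A c"
    using conic_domain.open_U[OF conic_domain_coord_dom[OF c]] ind_chart_in_coord_dom[OF v]
      open_contains_ball by blast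
  have "\<exists>u\<in>A. fst u = fst v \<and> snd u c = snd v c + w" if "norm w < e" for w
  proof -
    have "(snd c (fst v), snd v c + w) \<in> ball (ind_chart c v) e"
      using that by (simp add: ind_chart_def mem_ball dist_Pair_Pair dist_norm)
    then obtain u where u: "chart_at c u" "(snd c (fst v), snd v c + w) = ind_chart c u"
      using e(2) coord_domE[OF _ c] by blast
    then have "fst v = fst u"
      using inj_onD[OF inj_on_chart[OF c], of "fst v" "fst u"] v by (simp add: ind_chart_def chart_at_def)
    then show ?thesis
      using u by (auto simp: ind_chart_def chart_at_def)
  qed
  then show ?thesis
    using that e(1) by blast
qed

lemma chart_at_same_base: "chart_at c v \<Longrightarrow> u \<in> A \<Longrightarrow> fst u = fst v \<Longrightarrow> chart_at c u"
  by (simp add: chart_at_def)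

text \<open>Instead of applying the chain rule to the coordinate changes, observe that the product of the two
  Jacobians fixes the components of all vectors of the cone over the point. These fill an open set,
  so the product is the identity.\<close>

lemma jac_inverse:
  assumes v: "chart_at c v" "chart_at c' v"
  shows "(\<Sum>b\<in>UNIV. jac c c' (fst v) k b * jac c' c (fst v) b i) = (if k = i then 1 else 0)"
proof -
  let ?P = "\<lambda>k i. \<Sum>b\<in>UNIV. jac c c' (fst v) k b * jac c' c (fst v) b i"
  have P: "snd u c' $ k = (\<Sum>i\<in>UNIV. ?P k i * snd u c' $ i)" if "u \<in> A" "fst u = fst v" for u
  proof -
    have cu: "chart_at c u" "chart_at c' u"
      using v that chart_at_same_base by blast+
    have "snd u c' $ k = (\<Sum>b\<in>UNIV. jac c c' (fst v) k b * (\<Sum>i\<in>UNIV. jac c' c (fst v) b i * snd u c' $ i))"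
      using components_transform[OF cu, of k] components_transform[OF cu(2,1)] that by simp
    also have "\<dots> = (\<Sum>b\<in>UNIV. \<Sum>i\<in>UNIV. jac c c' (fst v) k b * jac c' c (fst v) b i * snd u c' $ i)"
      by (simp add: sum_distrib_left mult.assoc)
    also have "\<dots> = (\<Sum>i\<in>UNIV. \<Sum>b\<in>UNIV. jac c c' (fst v) k b * jac c' c (fst v) b i * snd u c' $ i)"
      by (rule sum.swap)
    finally show ?thesis
      by (simp add: sum_distrib_right)
  qed
  obtain e where e: "e > 0" "\<And>w. norm w < e \<Longrightarrow> \<exists>u\<in>A. fst u = fst v \<and> snd u c' = snd v c' + w"
    using fiber_neighbourhood[OF v(2)] by blast
  obtain u where u: "u \<in> A" "fst u = fst v" "snd u c' = snd v c' + (e / 2) *\<^sub>R axis i 1"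
    using e(1) e(2)[of "(e / 2) *\<^sub>R axis i 1"] by auto
  have 1: "(\<Sum>j\<in>UNIV. ?P k j * (e / 2 * (axis i 1 :: real^'n) $ j)) = e / 2 * (axis i 1 :: real^'n) $ k"
    using P[OF u(1,2)] P[of v] v unfolding u(3) by (simp add: chart_at_def distrib_left sum.distrib)
  have 2: "(\<Sum>j\<in>UNIV. ?P k j * (e / 2 * (axis i 1 :: real^'n) $ j)) = e / 2 * ?P k i"
    by (simp add: axis_def if_distrib[of "\<lambda>x. _ * x"] cong: if_cong)
  have "?P k i = (axis i 1 :: real^'n) $ k"
    using 1[unfolded 2] e(1) by simp
  then show ?thesis
    by (simp add: axis_def)
qed

text \<open>In the fiber over a point the coordinate change is linear, so the derivative along \<open>axis i 1\<close> in the
  chart \<open>c'\<close> is the derivative along the \<open>i\<close>-th column of the Jacobian in the chart \<open>c\<close>. The Jacobian is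
  constant along the fiber; thus \<open>F\<close> may contain its entries as coefficients.\<close>

lemma dy_transform:
  assumes v: "chart_at c v" "chart_at c' v"
    and F: "smooth_on (coord_dom A c) F" and F': "smooth_on (coord_dom A c') F'"
    and eq: "\<And>u. u \<in> A \<Longrightarrow> fst u = fst v \<Longrightarrow> F' (ind_chart c' u) = F (ind_chart c u)"
  shows "dy i F' (ind_chart c' v) = (\<Sum>a\<in>UNIV. jac c' c (fst v) a i * dy a F (ind_chart c v))"
proof -
  let ?w = "\<chi> a. jac c' c (fst v) a i"
  let ?D = "frechet_derivative F (at (ind_chart c v))" and ?D' = "frechet_derivative F' (at (ind_chart c' v))"
  have line: "((\<lambda>t. f (snd e (fst v), snd v e + t *\<^sub>R w)) has_derivative
      (\<lambda>t. frechet_derivative f (at (ind_chart e v)) (0, t *\<^sub>R w))) (at 0)"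
    if "chart_at e v" "smooth_on (coord_dom A e) f" for e f and w :: "real^'n"
  proof -
    have "((\<lambda>t. (snd e (fst v), snd v e + t *\<^sub>R w)) has_derivative (\<lambda>t. (0, t *\<^sub>R w))) (at 0)"
      by (auto intro!: derivative_eq_intros)
    moreover have "(f has_derivative frechet_derivative f (at (ind_chart e v))) (at (ind_chart e v))"
      by (rule smooth_on_imp_has_derivative[OF that(2) ind_chart_in_coord_dom[OF that(1)]])
    ultimately show ?thesis
      using has_derivative_compose[of "\<lambda>t. (snd e (fst v), snd v e + t *\<^sub>R w)" _ 0 UNIV f
          "frechet_derivative f (at (ind_chart e v))"]
      by (simp add: ind_chart_def o_def)
  qed
  obtain e where e: "e > 0" "\<And>w. norm w < e \<Longrightarrow> \<exists>u\<in>A. fst u = fst v \<and> snd u c' = snd v c' + w"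
    using fiber_neighbourhood[OF v(2)] by blast
  have "F' (snd c' (fst v), snd v c' + t *\<^sub>R axis i 1) = F (snd c (fst v), snd v c + t *\<^sub>R ?w)"
    if t: "t \<in> ball 0 e" for t
  proof -
    obtain u where u: "u \<in> A" "fst u = fst v" "snd u c' = snd v c' + t *\<^sub>R axis i 1"
      using e(2)[of "t *\<^sub>R axis i 1"] t by auto
    have cu: "chart_at c u" "chart_at c' u"
      using v u chart_at_same_base by blast+
    have "snd u c = snd v c + t *\<^sub>R ?w"
      unfolding vec_eq_iff
    proof
      fix a
      have "snd u c $ a = (\<Sum>j\<in>UNIV. jac c' c (fst v) a j * (snd v c' $ j + t * (axis i 1 :: real^'n) $ j))"
        using components_transform[OF cu(2,1), of a] u by simp
      also have "\<dots> = snd v c $ a + (\<Sum>j\<in>UNIV. jac c' c (fst v) a j * (t * (axis i 1 :: real^'n) $ j))"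
        using components_transform[OF v(2,1), of a] by (simp add: distrib_left sum.distrib)
      also have "(\<Sum>j\<in>UNIV. jac c' c (fst v) a j * (t * (axis i 1 :: real^'n) $ j)) = t * jac c' c (fst v) a i"
        by (simp add: axis_def if_distrib[of "\<lambda>x. _ * x"] cong: if_cong)
      finally show "snd u c $ a = (snd v c + t *\<^sub>R ?w) $ a"
        by simp
    qed
    then show ?thesis
      using eq[OF u(1,2)] u by (simp add: ind_chart_def)
  qed
  then have "((\<lambda>t. F (snd c (fst v), snd v c + t *\<^sub>R ?w)) has_derivative (\<lambda>t. ?D' (0, t *\<^sub>R axis i 1))) (at 0)"
    using e(1) by (intro has_derivative_transform_within_open[OF line[OF v(2) F'] open_ball[of 0 e]]) auto
  from has_derivative_unique[OF this line[OF v(1) F]]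
  have "?D' (0, 1 *\<^sub>R axis i 1) = ?D (0, 1 *\<^sub>R ?w)"
    by (rule fun_cong)
  then show ?thesis
    using derivative_along_fiber[OF smooth_on_imp_has_derivative[OF F ind_chart_in_coord_dom[OF v(1)]], of ?w]
    by (simp add: dy_def)
qed

end

section \<open>Components of anisotropic tensors\<close>

definition form_comp ::
  "('a, 'n::finite) chart set \<Rightarrow> ('a, 'n) chart \<Rightarrow> ('a, 'n, real^'n) aniso \<Rightarrow> 'n \<Rightarrow> 'n coords \<Rightarrow> real" where
  "form_comp \<A> c Q i z = local_fun \<A> c (\<lambda>v. Q v c) z $ i"

context tangent_cone
begin

lemma local_comp_ind_chart: "chart_at c v \<Longrightarrow> local_comp \<A> c T k i (ind_chart c v) = T v c $ k $ i"
  by (simp add: local_comp_def local_fun_ind_chart)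

lemma form_comp_ind_chart: "chart_at c v \<Longrightarrow> form_comp \<A> c Q i (ind_chart c v) = Q v c $ i"
  by (simp add: form_comp_def local_fun_ind_chart)

lemma pos_homogeneous_local_fun:
  assumes "pos_homogeneous A \<alpha> F" "c \<in> \<A>" "z \<in> coord_dom A c" "r > 0"
  shows "local_fun \<A> c F (fst z, r *\<^sub>R snd z) = (r powr \<alpha>) *\<^sub>R local_fun \<A> c F z"
proof -
  obtain v where v: "chart_at c v" "z = ind_chart c v"
    using coord_domE[OF assms(3,2)] .
  then have "local_fun \<A> c F (fst z, r *\<^sub>R snd z) = F (scale_tvec r v)"
    using local_fun_ind_chart[OF chart_at_scale[OF v(1) assms(4)]] by (simp add: ind_chart_scale)
  also have "\<dots> = (r powr \<alpha>) *\<^sub>R F v"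
    using assms v by (simp add: pos_homogeneous_def chart_at_def)
  finally show ?thesis
    by (simp add: v(2) local_fun_ind_chart[OF v(1)])
qed

lemma smooth_local_comp:
  "smooth_hom_components \<A> A \<alpha> T \<Longrightarrow> c \<in> \<A> \<Longrightarrow> smooth_on (coord_dom A c) (local_comp \<A> c T k i)"
  unfolding local_comp_def smooth_hom_components_def
  by (intro smooth_on_vec_nth conic_domain.open_U[OF conic_domain_coord_dom]) auto

lemma homogeneous_local_comp:
  "smooth_hom_components \<A> A \<alpha> T \<Longrightarrow> c \<in> \<A> \<Longrightarrow>
     fiber_homogeneous (coord_dom A c) \<alpha> (local_comp \<A> c T k i)"
  using pos_homogeneous_local_fun[of \<alpha> "\<lambda>v. T v c" c]
  by (simp add: fiber_homogeneous_def local_comp_def smooth_hom_components_def)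

lemma smooth_form_comp:
  "smooth_hom_components \<A> A \<alpha> Q \<Longrightarrow> c \<in> \<A> \<Longrightarrow> smooth_on (coord_dom A c) (form_comp \<A> c Q i)"
  unfolding form_comp_def smooth_hom_components_def
  by (intro smooth_on_vec_nth conic_domain.open_U[OF conic_domain_coord_dom]) auto

lemma homogeneous_form_comp:
  "smooth_hom_components \<A> A \<alpha> Q \<Longrightarrow> c \<in> \<A> \<Longrightarrow>
     fiber_homogeneous (coord_dom A c) \<alpha> (form_comp \<A> c Q i)"
  using pos_homogeneous_local_fun[of \<alpha> "\<lambda>v. Q v c" c]
  by (simp add: fiber_homogeneous_def form_comp_def smooth_hom_components_def)

lemma local_comp_add_tensor_canonical:
  assumes "c \<in> \<A>" "z \<in> coord_dom A c"
  shows "local_comp \<A> c (N + tensor_canonical Q) k i z = shift (local_comp \<A> c N) (form_comp \<A> c Q) k i z"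
proof -
  obtain v where v: "chart_at c v" "z = ind_chart c v"
    using coord_domE[OF assms(2,1)] .
  then show ?thesis
    by (simp add: shift_def local_comp_ind_chart form_comp_ind_chart snd_ind_chart tensor_canonical_def)
qed

lemma smooth_hom_components_add_tensor_canonical:
  assumes N: "smooth_hom_components \<A> A 1 N" and Q: "smooth_hom_components \<A> A 0 Q"
  shows "smooth_hom_components \<A> A 1 (N + tensor_canonical Q)"
  unfolding smooth_hom_components_def
proof (intro conjI ballI allI impI)
  fix c assume c: "c \<in> \<A>"
  interpret conic_domain "coord_dom A c"
    by (rule conic_domain_coord_dom[OF c])
  have "smooth_on (coord_dom A c) (local_comp \<A> c (N + tensor_canonical Q) k i)" for k i
  proof (rule smooth_on_cong[OF open_U])
    show "smooth_on (coord_dom A c) (shift (local_comp \<A> c N) (form_comp \<A> c Q) k i)"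
      unfolding shift_def
      by (intro smooth_intros smooth_coord smooth_local_comp[OF N c] smooth_form_comp[OF Q c])
  qed (simp add: local_comp_add_tensor_canonical c)
  then show "smooth_on (coord_dom A c) (local_fun \<A> c (\<lambda>v. (N + tensor_canonical Q) v c))"
    unfolding local_comp_def by (intro smooth_on_vec open_U)
  show "pos_homogeneous A 1 (\<lambda>v. (N + tensor_canonical Q) v c)"
    using N Q c unfolding smooth_hom_components_def pos_homogeneous_def
    by (simp add: vec_eq_iff tensor_canonical_def algebra_simps)
next
  fix v c assume "\<not> (v \<in> A \<and> c \<in> \<A> \<and> fst v \<in> fst c)"
  then have "N v c = 0" "Q v c = 0"
    using N Q unfolding smooth_hom_components_def by blast+
  then show "(N + tensor_canonical Q) v c = 0"
    by (simp add: vec_eq_iff tensor_canonical_def)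
qed

lemma hT01I:
  assumes "smooth_hom_components \<A> A \<alpha> Q"
    "\<And>v c c' i. chart_at c v \<Longrightarrow> chart_at c' v \<Longrightarrow>
       Q v c' $ i = (\<Sum>a\<in>UNIV. jac c' c (fst v) a i * Q v c $ a)"
  shows "Q \<in> hT01 \<A> A \<alpha>"
  using assms unfolding hT01_def chart_at_def by blast

lemma hT11I:
  assumes "smooth_hom_components \<A> A \<alpha> T"
    "\<And>v c c' i k. chart_at c v \<Longrightarrow> chart_at c' v \<Longrightarrow> T v c' $ k $ i =
       (\<Sum>b\<in>UNIV. \<Sum>a\<in>UNIV. jac c c' (fst v) k b * jac c' c (fst v) a i * T v c $ b $ a)"
  shows "T \<in> hT11 \<A> A \<alpha>"
  using assms unfolding hT11_def chart_at_def by blast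

lemma hT01_transform:
  "Q \<in> hT01 \<A> A \<alpha> \<Longrightarrow> chart_at c v \<Longrightarrow> chart_at c' v \<Longrightarrow>
     Q v c' $ i = (\<Sum>a\<in>UNIV. jac c' c (fst v) a i * Q v c $ a)"
  by (simp add: hT01_def chart_at_def)

lemma hT11_transform:
  "T \<in> hT11 \<A> A \<alpha> \<Longrightarrow> chart_at c v \<Longrightarrow> chart_at c' v \<Longrightarrow>
     T v c' $ k $ i = (\<Sum>b\<in>UNIV. \<Sum>a\<in>UNIV. jac c c' (fst v) k b * jac c' c (fst v) a i * T v c $ b $ a)"
  by (simp add: hT11_def chart_at_def)

lemma tensor_canonical_transform:
  assumes Q: "Q \<in> hT01 \<A> A \<alpha>" and v: "chart_at c v" "chart_at c' v"
  shows "tensor_canonical Q v c' $ k $ i =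
    (\<Sum>b\<in>UNIV. \<Sum>a\<in>UNIV. jac c c' (fst v) k b * jac c' c (fst v) a i * tensor_canonical Q v c $ b $ a)"
proof -
  have "tensor_canonical Q v c' $ k $ i =
      (\<Sum>b\<in>UNIV. jac c c' (fst v) k b * snd v c $ b) * (\<Sum>a\<in>UNIV. jac c' c (fst v) a i * Q v c $ a)"
    using hT01_transform[OF Q v, of i] components_transform[OF v, of k] by (simp add: tensor_canonical_def)
  then show ?thesis
    by (simp add: sum_product tensor_canonical_def mult.assoc mult.left_commute mult.commute)
qed

lemma hT11_add_tensor_canonical:
  assumes T: "T \<in> hT11 \<A> A 1" and Q: "Q \<in> hT01 \<A> A 0"
  shows "T + tensor_canonical Q \<in> hT11 \<A> A 1"
proof -
  have "smooth_hom_components \<A> A 1 (T + tensor_canonical Q)"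
    using T Q by (intro smooth_hom_components_add_tensor_canonical) (auto simp: hT11_def hT01_def)
  moreover have "(T + tensor_canonical Q) v c' $ k $ i = (\<Sum>b\<in>UNIV. \<Sum>a\<in>UNIV.
      jac c c' (fst v) k b * jac c' c (fst v) a i * (T + tensor_canonical Q) v c $ b $ a)"
    if "chart_at c v" "chart_at c' v" for v c c' k i
    using hT11_transform[OF T that] tensor_canonical_transform[OF Q that]
    by (simp add: distrib_left sum.distrib)
  ultimately show ?thesis
    by (rule hT11I)
qed

lemma connection_add_tensor_canonical:
  assumes N: "N \<in> hom_nonlinear_connections \<A> A" and Q: "Q \<in> hT01 \<A> A 0"
  shows "N + tensor_canonical Q \<in> hom_nonlinear_connections \<A> A"
proof -
  have "smooth_hom_components \<A> A 1 (N + tensor_canonical Q)"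
    using N Q by (intro smooth_hom_components_add_tensor_canonical)
      (auto simp: hom_nonlinear_connections_def hT01_def)
  moreover have "(N + tensor_canonical Q) v c' $ k $ i =
      (\<Sum>d\<in>UNIV. \<Sum>b\<in>UNIV. jac c c' (fst v) k d * hess c' c (fst v) d i b * snd v c' $ b) +
      (\<Sum>d\<in>UNIV. \<Sum>a\<in>UNIV.
        jac c c' (fst v) k d * jac c' c (fst v) a i * (N + tensor_canonical Q) v c $ d $ a)"
    if "chart_at c v" "chart_at c' v" for v c c' k i
    using N that tensor_canonical_transform[OF Q that]
    by (simp add: hom_nonlinear_connections_def chart_at_def distrib_left sum.distrib)
  ultimately show ?thesis
    unfolding hom_nonlinear_connections_def chart_at_def by blast
qed

lemma hT01_diff:
  assumes P: "P \<in> hT01 \<A> A \<alpha>" and Q: "Q \<in> hT01 \<A> A \<alpha>"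
  shows "P - Q \<in> hT01 \<A> A \<alpha>"
proof -
  have "smooth_on (coord_dom A c) (local_fun \<A> c (\<lambda>v. (P - Q) v c))" if "c \<in> \<A>" for c
  proof -
    interpret conic_domain "coord_dom A c"
      by (rule conic_domain_coord_dom[OF that])
    have "smooth_on (coord_dom A c) (\<lambda>z. local_fun \<A> c (\<lambda>v. P v c) z - local_fun \<A> c (\<lambda>v. Q v c) z)"
      using P Q that by (intro smooth_intros) (auto simp: hT01_def smooth_hom_components_def)
    then show ?thesis
      by (simp add: local_fun_def[abs_def])
  qed
  moreover have "pos_homogeneous A \<alpha> (\<lambda>v. (P - Q) v c)" if "c \<in> \<A>" for c
    using P Q that
    by (simp add: hT01_def smooth_hom_components_def pos_homogeneous_def scaleR_diff_right)
  moreover have "(P - Q) v c = 0" if "\<not> (v \<in> A \<and> c \<in> \<A> \<and> fst v \<in> fst c)" for v c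
  proof -
    have "P v c = 0" "Q v c = 0"
      using P Q that unfolding hT01_def smooth_hom_components_def by blast+
    then show ?thesis
      by simp
  qed
  moreover have "(P - Q) v c' $ i = (\<Sum>a\<in>UNIV. jac c' c (fst v) a i * (P - Q) v c $ a)"
    if "chart_at c v" "chart_at c' v" for v c c' i
    using hT01_transform[OF P that, of i] hT01_transform[OF Q that, of i]
    by (simp add: right_diff_distrib sum_subtractf)
  ultimately show ?thesis
    by (intro hT01I) (simp_all add: smooth_hom_components_def)
qed

lemma hT01_zero: "0 \<in> hT01 \<A> A \<alpha>"
  by (auto simp: hT01_def smooth_hom_components_def pos_homogeneous_def local_fun_def[abs_def]
      intro!: smooth_on_const conic_domain.open_U conic_domain_coord_dom)

lemma hT01_eqI:
  assumes "P \<in> hT01 \<A> A \<alpha>" "Q \<in> hT01 \<A> A \<alpha>" "\<And>v c i. chart_at c v \<Longrightarrow> P v c $ i = Q v c $ i"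
  shows "P = Q"
proof (intro ext)
  fix v c
  show "P v c = Q v c"
  proof (cases "chart_at c v")
    case True
    then show ?thesis
      using assms(3) by (simp add: vec_eq_iff)
  next
    case False
    then have "P v c = 0" "Q v c = 0"
      using assms(1,2) unfolding hT01_def smooth_hom_components_def chart_at_def by blast+
    then show ?thesis
      by simp
  qed
qed

lemma tensor_canonical_inj:
  assumes "P \<in> hT01 \<A> A \<alpha>" "Q \<in> hT01 \<A> A \<alpha>" "tensor_canonical P = tensor_canonical Q"
  shows "P = Q"
proof (rule hT01_eqI[OF assms(1,2)])
  fix v c i assume v: "chart_at c v"
  obtain k where k: "snd v c $ k \<noteq> 0"
    using component_nonzero[OF v] by (auto simp: vec_eq_iff)
  have "tensor_canonical P v c $ k $ i = tensor_canonical Q v c $ k $ i"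
    using assms(3) by simp
  then show "P v c $ i = Q v c $ i"
    using k by (simp add: tensor_canonical_def)
qed

section \<open>The symmetrizing one-form of a tensor\<close>

text \<open>By \<open>contracted_torsion_eq\<close> it suffices that \<open>J\<^sup>k\<^sub>a y\<^sup>a\<close> transforms as a vector and that its vertical
  derivative transforms by \<open>dy_transform\<close>.\<close>

lemma contracted_torsion_transform:
  assumes J: "J \<in> hT11 \<A> A 1" and v: "chart_at c v" "chart_at c' v"
  shows "contracted_torsion (local_comp \<A> c' J) k i (ind_chart c' v) =
    (\<Sum>b\<in>UNIV. \<Sum>a\<in>UNIV. jac c c' (fst v) k b * jac c' c (fst v) a i *
       contracted_torsion (local_comp \<A> c J) b a (ind_chart c v))"
proof -
  let ?J = "local_comp \<A> c J" and ?J' = "local_comp \<A> c' J"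
  let ?S = "\<lambda>k z. \<Sum>a\<in>UNIV. ?J k a z * snd z $ a" and ?S' = "\<lambda>k z. \<Sum>a\<in>UNIV. ?J' k a z * snd z $ a"
  let ?j = "jac c c' (fst v)" and ?j' = "jac c' c (fst v)"
  have c: "c \<in> \<A>" "c' \<in> \<A>"
    using v by (auto simp: chart_at_def)
  interpret U: conic_domain "coord_dom A c"
    by (rule conic_domain_coord_dom[OF c(1)])
  interpret U': conic_domain "coord_dom A c'"
    by (rule conic_domain_coord_dom[OF c(2)])
  have J_comp: "smooth_hom_components \<A> A 1 J"
    using J by (simp add: hT11_def)
  note sJ = smooth_local_comp[OF J_comp] and hJ = homogeneous_local_comp[OF J_comp]
  have S: "smooth_on (coord_dom A c) (?S b)" for b
    by (intro U.smooth_intros U.smooth_coord sJ c)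
  have S': "smooth_on (coord_dom A c') (?S' b)" for b
    by (intro U'.smooth_intros U'.smooth_coord sJ c)
  have S'_eq: "?S' k (ind_chart c' u) = (\<Sum>b\<in>UNIV. ?j k b * ?S b (ind_chart c u))"
    if u: "u \<in> A" "fst u = fst v" for u
  proof -
    have cu: "chart_at c u" "chart_at c' u"
      using v u chart_at_same_base by blast+
    have "?S' k (ind_chart c' u) =
        (\<Sum>i\<in>UNIV. \<Sum>b\<in>UNIV. \<Sum>a\<in>UNIV. ?j k b * ?j' a i * J u c $ b $ a * snd u c' $ i)"
      using hT11_transform[OF J cu] u
      by (simp add: local_comp_ind_chart cu snd_ind_chart sum_distrib_right)
    also have "\<dots> = (\<Sum>b\<in>UNIV. \<Sum>i\<in>UNIV. \<Sum>a\<in>UNIV. ?j k b * ?j' a i * J u c $ b $ a * snd u c' $ i)"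
      by (rule sum.swap)
    also have "\<dots> = (\<Sum>b\<in>UNIV. \<Sum>a\<in>UNIV. \<Sum>i\<in>UNIV. ?j k b * ?j' a i * J u c $ b $ a * snd u c' $ i)"
      by (intro sum.cong refl sum.swap)
    also have "\<dots> = (\<Sum>b\<in>UNIV. ?j k b * (\<Sum>a\<in>UNIV. J u c $ b $ a * (\<Sum>i\<in>UNIV. ?j' a i * snd u c' $ i)))"
      by (simp add: sum_distrib_left mult_ac)
    also have "\<dots> = (\<Sum>b\<in>UNIV. ?j k b * ?S b (ind_chart c u))"
      using components_transform[OF cu(2,1)] u by (simp add: local_comp_ind_chart cu snd_ind_chart)
    finally show ?thesis .
  qed
  have "dy i (?S' k) (ind_chart c' v) =
      (\<Sum>a\<in>UNIV. ?j' a i * dy a (\<lambda>z. \<Sum>b\<in>UNIV. ?j k b * ?S b z) (ind_chart c v))"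
    by (rule dy_transform[OF v _ S' S'_eq]) (intro U.smooth_intros S)
  also have "\<dots> = (\<Sum>a\<in>UNIV. \<Sum>b\<in>UNIV. ?j' a i * (?j k b * dy a (?S b) (ind_chart c v)))"
  proof -
    have "dy a (\<lambda>z. \<Sum>b\<in>UNIV. ?j k b * ?S b z) (ind_chart c v) =
        (\<Sum>b\<in>UNIV. ?j k b * dy a (?S b) (ind_chart c v))" for a
      using ind_chart_in_coord_dom[OF v(1)]
      by (subst U.dy_sum) (auto intro!: U.smooth_intros S U.dy_cmult sum.cong)
    then show ?thesis
      by (simp only: sum_distrib_left)
  qed
  also have "\<dots> = (\<Sum>b\<in>UNIV. \<Sum>a\<in>UNIV. ?j k b * ?j' a i * dy a (?S b) (ind_chart c v))"
    by (subst sum.swap) (simp add: mult_ac)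
  finally have dS: "dy i (?S' k) (ind_chart c' v) = \<dots>" .
  have T': "contracted_torsion ?J' k i (ind_chart c' v) =
      2 * ?J' k i (ind_chart c' v) - dy i (?S' k) (ind_chart c' v)"
    by (intro U'.contracted_torsion_eq sJ hJ c ind_chart_in_coord_dom v)
  have T: "contracted_torsion ?J b a (ind_chart c v) =
      2 * ?J b a (ind_chart c v) - dy a (?S b) (ind_chart c v)" for b a
    by (intro U.contracted_torsion_eq sJ hJ c ind_chart_in_coord_dom v)
  show ?thesis
    unfolding T' T dS local_comp_ind_chart[OF v(1)] local_comp_ind_chart[OF v(2)] hT11_transform[OF J v]
    by (simp add: right_diff_distrib sum_subtractf sum_distrib_left mult_ac)
qed

lemma torsion_trace_invariant:
  assumes J: "J \<in> hT11 \<A> A 1" and v: "chart_at c v" "chart_at c' v"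
  shows "torsion_trace (local_comp \<A> c' J) (ind_chart c' v) = torsion_trace (local_comp \<A> c J) (ind_chart c v)"
proof -
  let ?T = "contracted_torsion (local_comp \<A> c J)"
  let ?j = "jac c c' (fst v)" and ?j' = "jac c' c (fst v)"
  have "(\<Sum>k\<in>UNIV. contracted_torsion (local_comp \<A> c' J) k k (ind_chart c' v)) =
      (\<Sum>k\<in>UNIV. \<Sum>b\<in>UNIV. \<Sum>a\<in>UNIV. ?j k b * ?j' a k * ?T b a (ind_chart c v))"
    by (simp add: contracted_torsion_transform[OF J v])
  also have "\<dots> = (\<Sum>b\<in>UNIV. \<Sum>k\<in>UNIV. \<Sum>a\<in>UNIV. ?j k b * ?j' a k * ?T b a (ind_chart c v))"
    by (rule sum.swap)
  also have "\<dots> = (\<Sum>b\<in>UNIV. \<Sum>a\<in>UNIV. \<Sum>k\<in>UNIV. ?j k b * ?j' a k * ?T b a (ind_chart c v))"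
    by (intro sum.cong refl sum.swap)
  also have "\<dots> = (\<Sum>b\<in>UNIV. \<Sum>a\<in>UNIV. (\<Sum>k\<in>UNIV. ?j' a k * ?j k b) * ?T b a (ind_chart c v))"
    unfolding sum_distrib_right by (intro sum.cong refl) (simp add: mult_ac)
  also have "\<dots> = (\<Sum>b\<in>UNIV. ?T b b (ind_chart c v))"
    by (simp add: jac_inverse[OF v(2,1)] if_distrib[of "\<lambda>x. x * _"] cong: if_cong)
  finally show ?thesis
    by (simp add: torsion_trace_def)
qed

end

text \<open>Tensors whose contracted torsion has the shape that the affine equation prescribes. The functions
  \<open>B\<close> may depend on the chart in an arbitrary way: their tensorial nature is a consequence.\<close>

locale solvable_tensor = tangent_cone M \<A> A
  for M :: "'a topology" and \<A> :: "('a, 'n::finite) chart set" and A :: "('a, 'n) tvec set" +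
  fixes J :: "('a, 'n, real^'n^'n) aniso" and B :: "('a, 'n) chart \<Rightarrow> 'n \<Rightarrow> 'n coords \<Rightarrow> real"
  assumes card: "CARD('n) \<ge> 2"
    and J: "J \<in> hT11 \<A> A 1"
    and torsion: "c \<in> \<A> \<Longrightarrow> z \<in> coord_dom A c \<Longrightarrow> contracted_torsion (local_comp \<A> c J) j i z =
      B c i z * snd z $ j - (if j = i then 1 else 0) * (\<Sum>b\<in>UNIV. B c b z * snd z $ b)"
begin

lemma components: "smooth_hom_components \<A> A 1 J"
  using J by (simp add: hT11_def)

lemma torsion_decomposition:
  assumes v: "chart_at c v"
  shows "contracted_torsion (local_comp \<A> c J) j i (ind_chart c v) =
    torsion_form (local_comp \<A> c J) i (ind_chart c v) * snd v c $ j
    - (if j = i then 1 else 0) * torsion_trace (local_comp \<A> c J) (ind_chart c v)"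
proof -
  have c: "c \<in> \<A>"
    using v by (simp add: chart_at_def)
  note dom = ind_chart_in_coord_dom[OF v]
  note eqs = conic_domain.torsion_trace_form_eq[OF conic_domain_coord_dom[OF c] card dom torsion[OF c dom]]
  show ?thesis
    unfolding eqs by (simp add: torsion[OF c dom] snd_ind_chart)
qed

text \<open>Transforming the decomposition \<open>T\<^sup>j\<^sub>i = B\<^sub>i y\<^sup>j - B\<^sub>0 \<delta>\<^sup>j\<^sub>i\<close> term by term and cancelling the invariant
  scalar part leaves the transformation law of \<open>B\<close> multiplied by \<open>y\<^sup>k\<close>; some \<open>y\<^sup>k\<close> is nonzero.\<close>

lemma torsion_form_transform:
  assumes v: "chart_at c v" "chart_at c' v"
  shows "torsion_form (local_comp \<A> c' J) i (ind_chart c' v) =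
    (\<Sum>a\<in>UNIV. jac c' c (fst v) a i * torsion_form (local_comp \<A> c J) a (ind_chart c v))"
proof -
  let ?j = "jac c c' (fst v)" and ?j' = "jac c' c (fst v)"
  let ?f = "\<lambda>a. torsion_form (local_comp \<A> c J) a (ind_chart c v)"
  let ?\<beta> = "torsion_trace (local_comp \<A> c J) (ind_chart c v)"
  obtain k where k: "snd v c' $ k \<noteq> 0"
    using component_nonzero[OF v(2)] by (auto simp: vec_eq_iff)
  have "torsion_form (local_comp \<A> c' J) i (ind_chart c' v) * snd v c' $ k - (if k = i then 1 else 0) * ?\<beta> =
      (\<Sum>b\<in>UNIV. \<Sum>a\<in>UNIV. ?j k b * ?j' a i * (?f a * snd v c $ b - (if b = a then 1 else 0) * ?\<beta>))"
    using contracted_torsion_transform[OF J v, of k i]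
    by (simp only: torsion_decomposition[OF v(1)] torsion_decomposition[OF v(2)] torsion_trace_invariant[OF J v])
  also have "\<dots> = (\<Sum>b\<in>UNIV. \<Sum>a\<in>UNIV. (?j k b * snd v c $ b) * (?j' a i * ?f a))
      - (\<Sum>b\<in>UNIV. \<Sum>a\<in>UNIV. if b = a then ?j k b * ?j' a i * ?\<beta> else 0)"
    unfolding sum_subtractf[symmetric] by (intro sum.cong refl) (simp add: algebra_simps)
  also have "\<dots> = (\<Sum>b\<in>UNIV. ?j k b * snd v c $ b) * (\<Sum>a\<in>UNIV. ?j' a i * ?f a)
      - (\<Sum>b\<in>UNIV. ?j k b * ?j' b i) * ?\<beta>"
    by (simp only: sum_product sum.delta' finite UNIV_I if_True) (simp only: sum_distrib_right)
  also have "\<dots> = (\<Sum>a\<in>UNIV. ?j' a i * ?f a) * snd v c' $ k - (if k = i then 1 else 0) * ?\<beta>"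
    unfolding components_transform[OF v, of k, symmetric] jac_inverse[OF v] by simp
  finally show ?thesis
    using k by simp
qed

lemma symmetrizer_transform:
  assumes v: "chart_at c v" "chart_at c' v"
  shows "symmetrizer (local_comp \<A> c' J) i (ind_chart c' v) =
    (\<Sum>a\<in>UNIV. jac c' c (fst v) a i * symmetrizer (local_comp \<A> c J) a (ind_chart c v))"
proof -
  have c: "c \<in> \<A>" "c' \<in> \<A>"
    using v by (auto simp: chart_at_def)
  have "dy i (torsion_trace (local_comp \<A> c' J)) (ind_chart c' v) =
      (\<Sum>a\<in>UNIV. jac c' c (fst v) a i * dy a (torsion_trace (local_comp \<A> c J)) (ind_chart c v))"
  proof (rule dy_transform[OF v])
    show "torsion_trace (local_comp \<A> c' J) (ind_chart c' u) = torsion_trace (local_comp \<A> c J) (ind_chart c u)"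
      if "u \<in> A" "fst u = fst v" for u
      using that v by (intro torsion_trace_invariant[OF J]) (auto intro: chart_at_same_base)
  qed (intro conic_domain.smooth_torsion_trace conic_domain_coord_dom smooth_local_comp[OF components] c)+
  then show ?thesis
    unfolding symmetrizer_def torsion_form_transform[OF v]
    by (simp add: sum_distrib_left sum.distrib[symmetric] algebra_simps)
qed

definition symmetrizing_form :: "('a, 'n, real^'n) aniso" where
  "symmetrizing_form v c =
     (if chart_at c v then (\<chi> i. symmetrizer (local_comp \<A> c J) i (ind_chart c v)) else 0)"

lemma form_comp_symmetrizing_form:
  assumes "c \<in> \<A>" "z \<in> coord_dom A c"
  shows "form_comp \<A> c symmetrizing_form i z = symmetrizer (local_comp \<A> c J) i z"
proof -
  obtain v where "chart_at c v" "z = ind_chart c v"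
    using coord_domE[OF assms(2,1)] .
  then show ?thesis
    by (simp add: form_comp_ind_chart symmetrizing_form_def)
qed

lemma symmetrizing_form_in_hT01: "symmetrizing_form \<in> hT01 \<A> A 0"
proof -
  have "smooth_on (coord_dom A c) (local_fun \<A> c (\<lambda>v. symmetrizing_form v c))" if c: "c \<in> \<A>" for c
  proof -
    interpret conic_domain "coord_dom A c"
      by (rule conic_domain_coord_dom[OF c])
    have "smooth_on (coord_dom A c) (form_comp \<A> c symmetrizing_form i)" for i
      by (rule smooth_on_cong[OF open_U _ smooth_symmetrizer[OF smooth_local_comp[OF components c]]])
         (simp add: form_comp_symmetrizing_form c)
    then show ?thesis
      unfolding form_comp_def by (intro smooth_on_vec open_U)
  qed
  moreover have "pos_homogeneous A 0 (\<lambda>v. symmetrizing_form v c)" if c: "c \<in> \<A>" for c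
    unfolding pos_homogeneous_def
  proof (intro ballI allI impI)
    fix v and r :: real assume v: "v \<in> A" and r: "r > 0"
    interpret conic_domain "coord_dom A c"
      by (rule conic_domain_coord_dom[OF c])
    show "symmetrizing_form (scale_tvec r v) c = (r powr 0) *\<^sub>R symmetrizing_form v c"
    proof (cases "chart_at c v")
      case True
      have "symmetrizer (local_comp \<A> c J) i (ind_chart c (scale_tvec r v)) =
          symmetrizer (local_comp \<A> c J) i (ind_chart c v)" for i
        using fiber_homogeneousD[OF homogeneous_symmetrizer[OF smooth_local_comp[OF components c]
            homogeneous_local_comp[OF components c]] ind_chart_in_coord_dom[OF True] r] r
        by (simp add: ind_chart_scale)
      then show ?thesis
        using True chart_at_scale[OF True r] r by (simp add: symmetrizing_form_def)
    next
      case False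
      then have "\<not> chart_at c (scale_tvec r v)"
        using v by (simp add: chart_at_def)
      with False show ?thesis
        by (simp add: symmetrizing_form_def)
    qed
  qed
  ultimately have "smooth_hom_components \<A> A 0 symmetrizing_form"
    unfolding smooth_hom_components_def by (simp add: symmetrizing_form_def chart_at_def)
  moreover have "symmetrizing_form v c' $ i = (\<Sum>a\<in>UNIV. jac c' c (fst v) a i * symmetrizing_form v c $ a)"
    if "chart_at c v" "chart_at c' v" for v c c' i
    using symmetrizer_transform[OF that, of i] that by (simp add: symmetrizing_form_def)
  ultimately show ?thesis
    by (rule hT01I)
qed

lemma symmetrized_tensor_symmetric:
  assumes c: "c \<in> \<A>" and z: "z \<in> coord_dom A c"
  shows "dy j (local_comp \<A> c (J + tensor_canonical symmetrizing_form) k i) z =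
    dy i (local_comp \<A> c (J + tensor_canonical symmetrizing_form) k j) z"
proof -
  interpret conic_domain "coord_dom A c"
    by (rule conic_domain_coord_dom[OF c])
  let ?J' = "J + tensor_canonical symmetrizing_form"
  let ?S = "shift (local_comp \<A> c J) (symmetrizer (local_comp \<A> c J))"
  have J': "smooth_hom_components \<A> A 1 ?J'"
    using hT11_add_tensor_canonical[OF J symmetrizing_form_in_hT01] by (simp add: hT11_def)
  have eq: "local_comp \<A> c ?J' k i w = ?S k i w" if "w \<in> coord_dom A c" for k i w
    using that by (simp add: local_comp_add_tensor_canonical[OF c] form_comp_symmetrizing_form[OF c] shift_def)
  have "contracted_torsion (local_comp \<A> c ?J') b a w = 0" if w: "w \<in> coord_dom A c" for a b w
  proof -
    have "dy d (local_comp \<A> c ?J' k i) w = dy d (?S k i) w" for d k i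
      by (rule dy_cong[OF eq w])
    then have "contracted_torsion (local_comp \<A> c ?J') b a w = contracted_torsion ?S b a w"
      by (simp add: contracted_torsion_def)
    also have "\<dots> = 0"
      by (rule symmetrizer_removes_torsion[OF card smooth_local_comp[OF components c]
            homogeneous_local_comp[OF components c] torsion[OF c] w])
    finally show ?thesis .
  qed
  then show ?thesis
    by (intro torsion_free_imp_symmetric smooth_local_comp[OF J' c] homogeneous_local_comp[OF J' c] z)
qed

end

section \<open>Solutions of the affine equation\<close>

locale pseudo_Finsler_cone = tangent_cone M \<A> A
  for M :: "'a topology" and \<A> :: "('a, 'n::finite) chart set" and A :: "('a, 'n) tvec set" +
  fixes L :: "('a, 'n) tvec \<Rightarrow> real"
  assumes card: "CARD('n) \<ge> 2"
    and finsler: "pseudo_Finsler \<A> A L"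
    and positive: "v \<in> A \<Longrightarrow> L v > 0"
begin

lemma conic_metric_coord_dom:
  assumes c: "c \<in> \<A>"
  shows "conic_metric (coord_dom A c) (local_fun \<A> c L)"
proof -
  interpret conic_domain "coord_dom A c"
    by (rule conic_domain_coord_dom[OF c])
  have L: "pos_homogeneous A 2 L"
    using finsler by (simp add: pseudo_Finsler_def)
  show ?thesis
  proof
    show "smooth_on (coord_dom A c) (local_fun \<A> c L)"
      using finsler c by (simp add: pseudo_Finsler_def)
    show "fiber_homogeneous (coord_dom A c) 2 (local_fun \<A> c L)"
      using pos_homogeneous_local_fun[OF L c] by (simp add: fiber_homogeneous_def)
    fix z assume z: "z \<in> coord_dom A c"
    then show "invertible (\<chi> i j. fund (local_fun \<A> c L) i j z)"
      using finsler c by (simp add: pseudo_Finsler_def)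
    obtain v where v: "chart_at c v" "z = ind_chart c v"
      using coord_domE[OF z c] .
    then show "local_fun \<A> c L z \<noteq> 0"
      using positive[of v] by (simp add: local_fun_ind_chart chart_at_def)
  qed
qed

lemma SolE:
  assumes "N \<in> Sol \<A> A L"
  obtains J where "N \<in> hom_nonlinear_connections \<A> A" "J \<in> hT11 \<A> A 1"
    "N = metric_connection \<A> A L + J"
    "\<And>c z i j. c \<in> \<A> \<Longrightarrow> z \<in> coord_dom A c \<Longrightarrow>
       affine_lhs (local_fun \<A> c L) (local_comp \<A> c J) i j z = 0"
proof -
  obtain J where "N \<in> hom_nonlinear_connections \<A> A" "J \<in> hT11 \<A> A 1"
    "N = metric_connection \<A> A L + J"
    "\<forall>c\<in>\<A>. \<forall>z\<in>coord_dom A c. \<forall>i j. affine_lhs (local_fun \<A> c L) (local_comp \<A> c J) i j z = 0"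
    using assms by (auto simp: Sol_def)
  then show ?thesis
    using that[of J] by blast
qed

lemma Sol_add_tensor_canonical:
  assumes N: "N \<in> Sol \<A> A L" and Q: "Q \<in> hT01 \<A> A 0"
  shows "N + tensor_canonical Q \<in> Sol \<A> A L"
proof -
  obtain J where N_conn: "N \<in> hom_nonlinear_connections \<A> A" and J: "J \<in> hT11 \<A> A 1"
    and N_eq: "N = metric_connection \<A> A L + J"
    and affine: "\<And>c z i j. c \<in> \<A> \<Longrightarrow> z \<in> coord_dom A c \<Longrightarrow>
       affine_lhs (local_fun \<A> c L) (local_comp \<A> c J) i j z = 0"
    using SolE[OF N] by metis
  have J_comp: "smooth_hom_components \<A> A 1 J" and Q_comp: "smooth_hom_components \<A> A 0 Q"
    using J Q by (auto simp: hT11_def hT01_def)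
  have "affine_lhs (local_fun \<A> c L) (local_comp \<A> c (J + tensor_canonical Q)) i j z = 0"
    if c: "c \<in> \<A>" and z: "z \<in> coord_dom A c" for c z i j
  proof -
    interpret conic_metric "coord_dom A c" "local_fun \<A> c L"
      by (rule conic_metric_coord_dom[OF c])
    have "affine_lhs (local_fun \<A> c L) (local_comp \<A> c (J + tensor_canonical Q)) i j z =
        affine_lhs (local_fun \<A> c L) (shift (local_comp \<A> c J) (form_comp \<A> c Q)) i j z"
      by (rule affine_lhs_cong[OF local_comp_add_tensor_canonical[OF c] z])
    also have "\<dots> = affine_lhs (local_fun \<A> c L) (local_comp \<A> c J) i j z"
      by (rule affine_lhs_shift[OF smooth_local_comp[OF J_comp c] smooth_form_comp[OF Q_comp c]
            homogeneous_form_comp[OF Q_comp c] z])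
    finally show ?thesis
      using affine[OF c z] by simp
  qed
  moreover have "N + tensor_canonical Q = metric_connection \<A> A L + (J + tensor_canonical Q)"
    by (simp add: N_eq add.assoc)
  ultimately show ?thesis
    using connection_add_tensor_canonical[OF N_conn Q] hT11_add_tensor_canonical[OF J Q]
    unfolding Sol_def by blast
qed

text \<open>The metric connection is a vertical derivative of the spray, hence itself symmetric.\<close>

lemma symmetric_metric_connection_add:
  assumes J: "J \<in> hT11 \<A> A 1"
    and sym: "\<And>c z i j k. c \<in> \<A> \<Longrightarrow> z \<in> coord_dom A c \<Longrightarrow>
      dy j (local_comp \<A> c J k i) z = dy i (local_comp \<A> c J k j) z"
  shows "symmetric_connection \<A> A (metric_connection \<A> A L + J)"
  unfolding symmetric_connection_def
proof (intro ballI allI)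
  fix c z i j k assume c: "c \<in> \<A>" and z: "z \<in> coord_dom A c"
  interpret conic_metric "coord_dom A c" "local_fun \<A> c L"
    by (rule conic_metric_coord_dom[OF c])
  let ?N = "metric_connection \<A> A L + J" and ?b = "berwald (local_fun \<A> c L)"
  have J_comp: "smooth_hom_components \<A> A 1 J"
    using J by (simp add: hT11_def)
  have eq: "local_comp \<A> c ?N k i w = ?b k i w + local_comp \<A> c J k i w" if w: "w \<in> coord_dom A c" for k i w
  proof -
    obtain v where v: "chart_at c v" "w = ind_chart c v"
      using coord_domE[OF w c] .
    then show ?thesis
      by (simp add: local_comp_ind_chart metric_connection_def chart_at_def)
  qed
  have "dy j (local_comp \<A> c ?N k i) z = dy j (\<lambda>w. ?b k i w + local_comp \<A> c J k i w) z" for k i j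
    by (rule dy_cong[OF eq z])
  also have "\<dots> k i j = dy j (?b k i) z + dy j (local_comp \<A> c J k i) z" for k i j
    by (rule dy_add[OF smooth_berwald smooth_local_comp[OF J_comp c] z])
  finally show "dy j (local_comp \<A> c ?N k i) z - dy i (local_comp \<A> c ?N k j) z = 0"
    using berwald_symmetric[OF z, of j k i] sym[OF c z, of j k i] by simp
qed

lemma symmetrization_exists:
  assumes N: "N \<in> Sol \<A> A L"
  shows "\<exists>N'\<in>Sol_sym \<A> A L. \<exists>T\<in>hT01 \<A> A 0. N = N' + tensor_canonical T"
proof -
  obtain J where J: "J \<in> hT11 \<A> A 1" and N_eq: "N = metric_connection \<A> A L + J"
    and affine: "\<And>c z i j. c \<in> \<A> \<Longrightarrow> z \<in> coord_dom A c \<Longrightarrow>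
       affine_lhs (local_fun \<A> c L) (local_comp \<A> c J) i j z = 0"
    using SolE[OF N] by metis
  interpret solvable_tensor M \<A> A J "\<lambda>c. affine_brace (local_fun \<A> c L) (local_comp \<A> c J)"
  proof
    fix c z j i assume c: "c \<in> \<A>" and z: "z \<in> coord_dom A c"
    interpret conic_metric "coord_dom A c" "local_fun \<A> c L"
      by (rule conic_metric_coord_dom[OF c])
    show "contracted_torsion (local_comp \<A> c J) j i z =
        affine_brace (local_fun \<A> c L) (local_comp \<A> c J) i z * snd z $ j
        - (if j = i then 1 else 0) * (\<Sum>b\<in>UNIV. affine_brace (local_fun \<A> c L) (local_comp \<A> c J) b z * snd z $ b)"
      using affine[OF c z, of i j] unfolding affine_lhs_eq by simp
  qed (use card J in auto)
  let ?Q = "symmetrizing_form"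
  let ?N' = "N + tensor_canonical ?Q"
  note Q = symmetrizing_form_in_hT01
  have "symmetric_connection \<A> A (metric_connection \<A> A L + (J + tensor_canonical ?Q))"
    by (rule symmetric_metric_connection_add[OF hT11_add_tensor_canonical[OF J Q] symmetrized_tensor_symmetric])
  then have "?N' \<in> Sol_sym \<A> A L"
    using Sol_add_tensor_canonical[OF N Q] by (simp add: Sol_sym_def N_eq add.assoc)
  moreover have "N = ?N' + tensor_canonical (0 - ?Q)"
    by (intro ext) (simp add: vec_eq_iff tensor_canonical_def)
  ultimately show ?thesis
    using hT01_diff[OF hT01_zero Q] by blast
qed

lemma contracted_torsion_symmetric:
  assumes "N \<in> Sol_sym \<A> A L" "c \<in> \<A>" "z \<in> coord_dom A c"
  shows "contracted_torsion (local_comp \<A> c N) j i z = 0"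
  using assms by (simp add: Sol_sym_def symmetric_connection_def contracted_torsion_def)

text \<open>Symmetric connections have zero contracted torsion, so the difference \<open>Q \<otimes> \<C>\<close> of the two does not
  change the contracted torsion, and \<open>contracted_torsion_shift_inj\<close> gives \<open>Q = 0\<close>.\<close>

lemma symmetrization_unique:
  assumes N': "N' \<in> Sol_sym \<A> A L" and N'': "N'' \<in> Sol_sym \<A> A L"
    and T': "T' \<in> hT01 \<A> A 0" and T'': "T'' \<in> hT01 \<A> A 0"
    and eq: "N' + tensor_canonical T' = N'' + tensor_canonical T''"
  shows "N' = N''"
proof -
  let ?Q = "T' - T''"
  have Q: "?Q \<in> hT01 \<A> A 0"
    by (rule hT01_diff[OF T' T''])
  have N''_eq: "N'' = N' + tensor_canonical ?Q"
  proof (intro ext)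
    fix v c
    have "N' v c + tensor_canonical T' v c = N'' v c + tensor_canonical T'' v c"
      using fun_cong[OF fun_cong[OF eq, of v], of c] by simp
    then show "N'' v c = (N' + tensor_canonical ?Q) v c"
      by (simp add: vec_eq_iff tensor_canonical_def left_diff_distrib algebra_simps)
  qed
  have N'_comp: "smooth_hom_components \<A> A 1 N'"
    using N' by (simp add: Sol_sym_def Sol_def hom_nonlinear_connections_def)
  have Q_comp: "smooth_hom_components \<A> A 0 ?Q"
    using Q by (simp add: hT01_def)
  have "?Q = 0"
  proof (rule hT01_eqI[OF Q hT01_zero])
    fix v c i assume v: "chart_at c v"
    then have c: "c \<in> \<A>"
      by (simp add: chart_at_def)
    interpret conic_domain "coord_dom A c"
      by (rule conic_domain_coord_dom[OF c])
    let ?S = "shift (local_comp \<A> c N') (form_comp \<A> c ?Q)"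
    have same_torsion: "contracted_torsion ?S j i z = contracted_torsion (local_comp \<A> c N') j i z"
      if z: "z \<in> coord_dom A c" for z j i
    proof -
      have "dy d (local_comp \<A> c N'' k i) z = dy d (?S k i) z" for d k i
        by (rule dy_cong[OF _ z]) (simp only: N''_eq local_comp_add_tensor_canonical[OF c])
      then have "contracted_torsion ?S j i z = contracted_torsion (local_comp \<A> c N'') j i z"
        by (simp add: contracted_torsion_def)
      then show ?thesis
        by (simp add: contracted_torsion_symmetric[OF _ c z] N' N'')
    qed
    have "form_comp \<A> c ?Q i (ind_chart c v) = 0"
      by (rule contracted_torsion_shift_inj[OF card smooth_local_comp[OF N'_comp c]
          smooth_form_comp[OF Q_comp c] homogeneous_form_comp[OF Q_comp c] same_torsion
          ind_chart_in_coord_dom[OF v]])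
    then show "?Q v c $ i = 0 v c $ i"
      using form_comp_ind_chart[OF v, of ?Q i] by simp
  qed
  then have "tensor_canonical ?Q = 0"
    by (intro ext) (simp add: vec_eq_iff tensor_canonical_def)
  then show ?thesis
    using N''_eq by simp
qed

lemma symmetrization_ex1:
  assumes "N \<in> Sol \<A> A L"
  shows "\<exists>!N'. N' \<in> Sol_sym \<A> A L \<and> (\<exists>T\<in>hT01 \<A> A 0. N = N' + tensor_canonical T)"
proof (rule ex_ex1I)
  show "\<exists>N'. N' \<in> Sol_sym \<A> A L \<and> (\<exists>T\<in>hT01 \<A> A 0. N = N' + tensor_canonical T)"
    using symmetrization_exists[OF assms] by blast
  show "N' = N''"
    if "N' \<in> Sol_sym \<A> A L \<and> (\<exists>T\<in>hT01 \<A> A 0. N = N' + tensor_canonical T)"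
      "N'' \<in> Sol_sym \<A> A L \<and> (\<exists>T\<in>hT01 \<A> A 0. N = N'' + tensor_canonical T)" for N' N''
    using that symmetrization_unique[of N' N''] by metis
qed

lemma fiber_bij:
  assumes N0: "N\<^sub>0 \<in> Sol_sym \<A> A L"
  shows "bij_betw (\<lambda>T. N\<^sub>0 + tensor_canonical T) (hT01 \<A> A 0)
    {N \<in> Sol \<A> A L. sym_projection \<A> A L N = N\<^sub>0}"
  unfolding bij_betw_def
proof
  show "inj_on (\<lambda>T. N\<^sub>0 + tensor_canonical T) (hT01 \<A> A 0)"
    using tensor_canonical_inj by (auto intro!: inj_onI)
  show "(\<lambda>T. N\<^sub>0 + tensor_canonical T) ` hT01 \<A> A 0 = {N \<in> Sol \<A> A L. sym_projection \<A> A L N = N\<^sub>0}"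
  proof (intro equalityI subsetI)
    fix N assume "N \<in> (\<lambda>T. N\<^sub>0 + tensor_canonical T) ` hT01 \<A> A 0"
    then obtain T where T: "T \<in> hT01 \<A> A 0" "N = N\<^sub>0 + tensor_canonical T"
      by blast
    have N: "N \<in> Sol \<A> A L"
      using Sol_add_tensor_canonical[OF _ T(1)] N0 T(2) by (simp add: Sol_sym_def)
    have "sym_projection \<A> A L N = N\<^sub>0"
      unfolding sym_projection_def
      by (rule the1_equality[OF symmetrization_ex1[OF N]]) (use N0 T in blast)
    with N show "N \<in> {N \<in> Sol \<A> A L. sym_projection \<A> A L N = N\<^sub>0}"
      by blast
  next
    fix N assume "N \<in> {N \<in> Sol \<A> A L. sym_projection \<A> A L N = N\<^sub>0}"
    then have N: "N \<in> Sol \<A> A L" "sym_projection \<A> A L N = N\<^sub>0"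
      by auto
    show "N \<in> (\<lambda>T. N\<^sub>0 + tensor_canonical T) ` hT01 \<A> A 0"
      using theI'[OF symmetrization_ex1[OF N(1)]] N(2) unfolding sym_projection_def by blast
  qed
qed

end

theorem theoremA:
  fixes M :: "'a topology"
    and \<A> :: "('a, 'n::finite) chart set"
    and A :: "('a, 'n) tvec set"
    and L :: "('a, 'n) tvec \<Rightarrow> real"
  assumes "CARD('n) \<ge> 2"
    and "smooth_manifold M \<A>"
    and "connected_space M"
    and "open_conic M \<A> A"
    and "pseudo_Finsler \<A> A L"
    and "\<forall>v\<in>A. L v > 0"
  shows "(\<forall>N\<in>Sol \<A> A L. \<exists>!N'. N' \<in> Sol_sym \<A> A L \<and>
            (\<exists>T\<in>hT01 \<A> A 0. N = N' + tensor_canonical T)) \<and>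
         (\<forall>N\<^sub>0\<in>Sol_sym \<A> A L.
            bij_betw (\<lambda>T. N\<^sub>0 + tensor_canonical T) (hT01 \<A> A 0)
              {N \<in> Sol \<A> A L. sym_projection \<A> A L N = N\<^sub>0})"
proof -
  interpret pseudo_Finsler_cone M \<A> A L
    using assms by unfold_locales auto
  show ?thesis
    using symmetrization_ex1 fiber_bij by blast
qed

end
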